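(* Let $G$ be a factorizable graph and let $X\subseteq V(G)$ be an odd-maximal barrier of $G$. Then $X$ is a disjoint union of some members of $\mathcal{P}(G)$; that is, there exist $S_1,\ldots,S_k\in\mathcal{P}(G)$ such that $X=S_1\,\dot\cup\,\cdots\,\dot\cup\, S_k$. Moreover, the vertex set $D_X$ of the odd components of $G-X$ satisfies $$D_X=\bigl(U^*(G_1)\setminus U^*(S_1)\bigr)\,\dot\cup\,\cdots\,\dot\cup\,\bigl(U^*(G_k)\setminus U^*(S_k)\bigr),$$ where, for each $i\in\{1,\ldots,k\}$, $G_i\in\mathcal{G}(G)$ is the factor-component with $S_i\in\mathcal{P}_G(G_i)$.
   Context: All graphs are finite. A matching is a set of pairwise disjoint edges; it is perfect if it covers all vertices. A graph is factorizable if it has a perfect matching, and factor-critical if deleting any single vertex yields the empty graph or a factorizable graph. For $X\subseteq V(G)$, $G[X]$ is the induced subgraph, $G-X=G[V(G)\setminus X]$, $G/X$ is the graph obtained by contracting $X$ into a single vertex, $\Gamma(X)$ is the set of vertices outside $X$ adjacent to some vertex of $X$. Let $G$ be factorizable. An edge is allowed if it lies in some perfect matching. For each connected component $C$ of the subgraph formed by the allowed edges, $G[V(C)]$ is a factor-component; $\mathcal{G}(G)$ is the set of factor-components. A set $X\subseteq V(G)$ is separating if every $H\in\mathcal{G}(G)$ has $V(H)\subseteq X$ or $V(H)\cap X=\emptyset$. Barriers: $q_G(X)$ is the number of odd components (components with an odd number of vertices) of $G-X$, $\nu(G)$ is the maximum matching size; $X$ is a barrier if $q_G(X)-|X|=|V(G)|-2\nu(G)$.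 $D_X$ denotes the set of vertices of the odd components of $G-X$ and $C_X=V(G)\setminus X\setminus D_X$. A barrier $X$ is odd-maximal if there is no nonempty $Y\subseteq D_X$ with $X\cup Y$ a barrier. Cathedral structure: for $G_1,G_2\in\mathcal{G}(G)$, write $G_1\trianglelefteq G_2$ if there is a separating set $X\supseteq V(G_1)\cup V(G_2)$ with $G[X]/V(G_1)$ factor-critical (this is a partial order on $\mathcal{G}(G)$). For $u,v\in V(G)$, $u\sim_G v$ if $u,v$ lie in the same factor-component and $G-u-v$ is not factorizable; this is an equivalence relation, and $\mathcal{P}(G)$ is its set of equivalence classes (the generalized canonical partition). For $H\in\mathcal{G}(G)$, $\mathcal{P}_G(H)=\{S\in\mathcal{P}(G):S\subseteq V(H)\}$ (a partition of $V(H)$). Let $\mathcal{U}^*(H)=\{H'\in\mathcal{G}(G):H\trianglelefteq H'\}$, $U^*(H)=\bigcup_{H'\in\mathcal{U}^*(H)}V(H')$, $U(H)=U^*(H)\setminus V(H)$. For $S\in\mathcal{P}_G(H)$, $\mathcal{U}(S)$ is the set of $H'\in\mathcal{G}(G)$ with $H\trianglelefteq H'$, $H'\neq H$, such that there is a connected component $K$ of $G[U(H)]$ with $\Gamma(K)\cap V(H)\subseteq S$ and $V(H')\subseteq V(K)$; $U(S)=\bigcup_{H'\in\mathcal{U}(S)}V(H')$ and $U^*(S)=U(S)\cup S$. *)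

theory Defs
  imports Main "HOL-Library.Disjoint_Sets"
begin

record 'a graph =
  verts :: "'a set"
  edges :: "'a set set"

definition fin_graph :: "'a graph \<Rightarrow> bool" where
  "fin_graph G \<longleftrightarrow> finite (verts G) \<and> (\<forall>e\<in>edges G. e \<subseteq> verts G \<and> card e = 2)"

definition induced :: "'a graph \<Rightarrow> 'a set \<Rightarrow> 'a graph" where
  "induced G X = \<lparr>verts = verts G \<inter> X, edges = {e \<in> edges G. e \<subseteq> X}\<rparr>"

definition delete :: "'a graph \<Rightarrow> 'a set \<Rightarrow> 'a graph" where
  "delete G X = induced G (verts G - X)"

text \<open>Contraction of \<open>X\<close>: \<open>None\<close> is the new vertex. Edges inside \<open>X\<close> would become loops and
  are dropped, and parallel edges are merged; neither affects the existence of matchings.\<close>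

definition contract :: "'a graph \<Rightarrow> 'a set \<Rightarrow> 'a option graph" where
  "contract G X =
     (let f = (\<lambda>v. if v \<in> X then None else Some v)
      in \<lparr>verts = f ` verts G, edges = {f ` e |e. e \<in> edges G \<and> \<not> e \<subseteq> X}\<rparr>)"

definition nbrs :: "'a graph \<Rightarrow> 'a set \<Rightarrow> 'a set" where
  "nbrs G X = {v \<in> verts G - X. \<exists>u\<in>X. {u, v} \<in> edges G}"

definition adj :: "'a graph \<Rightarrow> ('a \<times> 'a) set" where
  "adj G = {(u, v). {u, v} \<in> edges G}"

text \<open>Connected components are represented by their vertex sets.\<close>

definition components :: "'a graph \<Rightarrow> 'a set set" where
  "components G = verts G // (adj G)\<^sup>*"

definition matching :: "'a graph \<Rightarrow> 'a set set \<Rightarrow> bool" where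
  "matching G M \<longleftrightarrow> M \<subseteq> edges G \<and> disjoint M"

definition perfect_matching :: "'a graph \<Rightarrow> 'a set set \<Rightarrow> bool" where
  "perfect_matching G M \<longleftrightarrow> matching G M \<and> \<Union>M = verts G"

definition matching_number :: "'a graph \<Rightarrow> nat" where
  "matching_number G = Max {card M |M. matching G M}"

text \<open>The empty graph is factorizable, by the empty matching.\<close>

definition factorizable :: "'a graph \<Rightarrow> bool" where
  "factorizable G \<longleftrightarrow> (\<exists>M. perfect_matching G M)"

definition factor_critical :: "'a graph \<Rightarrow> bool" where
  "factor_critical G \<longleftrightarrow>
     (\<forall>v\<in>verts G. verts (delete G {v}) = {} \<or> factorizable (delete G {v}))"

definition allowed_edges :: "'a graph \<Rightarrow> 'a set set" where
  "allowed_edges G = {e \<in> edges G. \<exists>M. perfect_matching G M \<and> e \<in> M}"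

definition allowed_subgraph :: "'a graph \<Rightarrow> 'a graph" where
  "allowed_subgraph G = \<lparr>verts = \<Union>(allowed_edges G), edges = allowed_edges G\<rparr>"

definition factor_components :: "'a graph \<Rightarrow> 'a graph set" where
  "factor_components G = induced G ` components (allowed_subgraph G)"

definition separating :: "'a graph \<Rightarrow> 'a set \<Rightarrow> bool" where
  "separating G X \<longleftrightarrow>
     X \<subseteq> verts G \<and> (\<forall>H\<in>factor_components G. verts H \<subseteq> X \<or> verts H \<inter> X = {})"

definition odd_components :: "'a graph \<Rightarrow> 'a set \<Rightarrow> 'a set set" where
  "odd_components G X = {K \<in> components (delete G X). odd (card K)}"

definition odd_verts :: "'a graph \<Rightarrow> 'a set \<Rightarrow> 'a set" where
  "odd_verts G X = \<Union>(odd_components G X)"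

definition barrier :: "'a graph \<Rightarrow> 'a set \<Rightarrow> bool" where
  "barrier G X \<longleftrightarrow>
     X \<subseteq> verts G \<and>
     int (card (odd_components G X)) - int (card X) =
       int (card (verts G)) - 2 * int (matching_number G)"

definition odd_maximal_barrier :: "'a graph \<Rightarrow> 'a set \<Rightarrow> bool" where
  "odd_maximal_barrier G X \<longleftrightarrow>
     barrier G X \<and> \<not> (\<exists>Y. Y \<noteq> {} \<and> Y \<subseteq> odd_verts G X \<and> barrier G (X \<union> Y))"

definition cathedral_le :: "'a graph \<Rightarrow> 'a graph \<Rightarrow> 'a graph \<Rightarrow> bool" where
  "cathedral_le G H H' \<longleftrightarrow>
     H \<in> factor_components G \<and> H' \<in> factor_components G \<and>
     (\<exists>X. separating G X \<and> verts H \<union> verts H' \<subseteq> X \<and>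
          factor_critical (contract (induced G X) (verts H)))"

definition gen_canonical_rel :: "'a graph \<Rightarrow> ('a \<times> 'a) set" where
  "gen_canonical_rel G =
     {(u, v). (\<exists>H\<in>factor_components G. u \<in> verts H \<and> v \<in> verts H) \<and>
              \<not> factorizable (delete G {u, v})}"

definition gen_canonical_partition :: "'a graph \<Rightarrow> 'a set set" where
  "gen_canonical_partition G = verts G // gen_canonical_rel G"

definition partition_of :: "'a graph \<Rightarrow> 'a graph \<Rightarrow> 'a set set" where
  "partition_of G H = {S \<in> gen_canonical_partition G. S \<subseteq> verts H}"

definition upper_comps_star :: "'a graph \<Rightarrow> 'a graph \<Rightarrow> 'a graph set" where
  "upper_comps_star G H = {H' \<in> factor_components G. cathedral_le G H H'}"

definition upper_star :: "'a graph \<Rightarrow> 'a graph \<Rightarrow> 'a set" where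
  "upper_star G H = (\<Union>H'\<in>upper_comps_star G H. verts H')"

definition upper :: "'a graph \<Rightarrow> 'a graph \<Rightarrow> 'a set" where
  "upper G H = upper_star G H - verts H"

text \<open>For \<open>S\<close> in \<open>partition_of G H\<close>, the sets \<open>\<U>(S)\<close>, \<open>U(S)\<close> and \<open>U\<^sup>*(S)\<close>; the factor-component
  \<open>H\<close>, which is determined by \<open>S\<close>, is passed explicitly.\<close>

definition class_upper_comps :: "'a graph \<Rightarrow> 'a graph \<Rightarrow> 'a set \<Rightarrow> 'a graph set" where
  "class_upper_comps G H S =
     {H' \<in> factor_components G. cathedral_le G H H' \<and> H' \<noteq> H \<and>
        (\<exists>K\<in>components (induced G (upper G H)).
            nbrs G K \<inter> verts H \<subseteq> S \<and> verts H' \<subseteq> K)}"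

definition class_upper :: "'a graph \<Rightarrow> 'a graph \<Rightarrow> 'a set \<Rightarrow> 'a set" where
  "class_upper G H S = (\<Union>H'\<in>class_upper_comps G H S. verts H')"

definition class_upper_star :: "'a graph \<Rightarrow> 'a graph \<Rightarrow> 'a set \<Rightarrow> 'a set" where
  "class_upper_star G H S = class_upper G H S \<union> S"

end

(* For an odd-maximal barrier X of a factorizable graph, Berge's formula makes the odd components of
   G - X factor-critical, and a perfect matching joins each x in X to exactly one of them, oc x.
   Draw an arc from x to x' if x has a neighbour in oc x'. Two different perfect matchings compose to a
   permutation of X, hence allowed edges only join mutually reachable vertices; conversely, if x is
   reachable from x', then deleting x and any vertex of oc x' leaves a perfect matching. So the class
   of x is X Int H for the factor-component H of x. A parity argument shows that every oc x is the union
   of its part of H and of factor-components inside oc x. The latter are above H and not in U(S),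
   while everything else above H is cut off from the oc z with z in X Int H, since otherwise a closed
   walk of arcs would produce an allowed edge between H and another factor-component. *)

theory Submission
  imports Defs "HOL-Library.Transitive_Closure_Table"
begin

section \<open>Matchings and components of vertex sets\<close>

text \<open>Maximality of the barrier enters only through factor-criticality of the odd components,
  and this is what makes arcs composable: a vertex of \<open>X\<close> may be sent to any neighbour
  in its target component, because the rest of that component can always be matched. A perfect
  matching of \<open>G\<close> minus two vertices thus reduces to a bijection between subsets of
  \<open>X\<close>. The obstacle is that \<open>U(S)\<close> is cut out by the components of
  \<open>G[U(H)]\<close>, which know nothing of \<open>X\<close>. Such a component stays out of
  \<open>U(S)\<close> exactly when it touches \<open>H\<close> outside \<open>X\<close>, at a vertex
  of some \<open>oc z\<close> with \<open>z\<close> in both \<open>X\<close> and \<open>H\<close>.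
  It then has to be confined to \<open>oc z\<close>, so no vertex of \<open>X\<close> above
  \<open>H\<close> and outside \<open>H\<close> may be adjacent to \<open>oc z\<close>. The order
  supplies only a factor-critical contraction over some unknown separating set; a counting argument
  that works for any such set extracts from it the walk of arcs leading back.\<close>

text \<open>Matchings covering exactly \<open>A\<close> are represented by involutions on \<open>A\<close>.\<close>

definition mate :: "'a set set \<Rightarrow> 'a set \<Rightarrow> ('a \<Rightarrow> 'a) \<Rightarrow> bool" where
  "mate E A m \<longleftrightarrow> (\<forall>a\<in>A. m a \<in> A \<and> m (m a) = a \<and> {a, m a} \<in> E)"

definition matchable :: "'a set set \<Rightarrow> 'a set \<Rightarrow> bool" where
  "matchable E A \<longleftrightarrow> (\<exists>m. mate E A m)"

definition simple :: "'a set set \<Rightarrow> bool" where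
  "simple E \<longleftrightarrow> (\<forall>e\<in>E. card e = 2)"

lemma simple_neq: "simple E \<Longrightarrow> {a, b} \<in> E \<Longrightarrow> a \<noteq> b"
  by (force simp: simple_def)

lemma mateD:
  assumes "mate E A m" "a \<in> A"
  shows "m a \<in> A" "m (m a) = a" "{a, m a} \<in> E"
  using assms by (auto simp: mate_def)

lemma mate_neq: "simple E \<Longrightarrow> mate E A m \<Longrightarrow> a \<in> A \<Longrightarrow> m a \<noteq> a"
  by (metis mateD(3) simple_neq)

lemma mate_inj: "mate E A m \<Longrightarrow> a \<in> A \<Longrightarrow> b \<in> A \<Longrightarrow> m a = m b \<Longrightarrow> a = b"
  by (metis mateD(2))

lemma mate_subset: "mate E A m \<Longrightarrow> B \<subseteq> A \<Longrightarrow> (\<And>b. b \<in> B \<Longrightarrow> m b \<in> B) \<Longrightarrow> mate E B m"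
  by (auto simp: mate_def)

lemma matchableI: "mate E A m \<Longrightarrow> matchable E A"
  by (auto simp: matchable_def)

lemma matchable_empty [simp]: "matchable E {}"
  by (auto simp: matchable_def mate_def)

lemma mate_insert2:
  assumes "mate E A n" "{a, b} \<in> E" "a \<notin> A" "b \<notin> A" "a \<noteq> b"
  shows "mate E (insert a (insert b A)) (n(a := b, b := a))"
  unfolding mate_def
proof
  fix c assume "c \<in> insert a (insert b A)"
  then consider "c = a" | "c = b" | "c \<in> A" "c \<noteq> a" "c \<noteq> b" using assms(3,4) by blast
  then show "(n(a := b, b := a)) c \<in> insert a (insert b A) \<and>
      (n(a := b, b := a)) ((n(a := b, b := a)) c) = c \<and> {c, (n(a := b, b := a)) c} \<in> E"
  proof cases
    case 3
    note nc = mateD[OF assms(1) 3(1)]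
    have "n c \<noteq> a" "n c \<noteq> b" using nc(1) assms(3,4) by blast+
    then show ?thesis using nc 3 by simp
  qed (use assms in \<open>simp_all add: insert_commute\<close>)
qed

lemma matchable_UN:
  assumes "\<And>i. i \<in> I \<Longrightarrow> matchable E (A i)" "disjoint_family_on A I"
  shows "matchable E (\<Union>i\<in>I. A i)"
proof -
  obtain m where m: "\<And>i. i \<in> I \<Longrightarrow> mate E (A i) (m i)"
    using assms(1) unfolding matchable_def by metis
  define n where "n a = m (THE i. i \<in> I \<and> a \<in> A i) a" for a
  have n: "n a = m i a" if "i \<in> I" "a \<in> A i" for i a
  proof -
    have "(THE j. j \<in> I \<and> a \<in> A j) = i"
      using that assms(2) by (intro the_equality) (auto simp: disjoint_family_on_def)
    then show ?thesis by (simp add: n_def)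
  qed
  have "mate E (\<Union>i\<in>I. A i) n"
    unfolding mate_def
  proof
    fix a assume "a \<in> (\<Union>i\<in>I. A i)"
    then obtain i where i: "i \<in> I" "a \<in> A i" by blast
    with mateD[OF m[OF i(1)] i(2)] n[OF i] n[OF i(1), of "m i a"]
    show "n a \<in> (\<Union>i\<in>I. A i) \<and> n (n a) = a \<and> {a, n a} \<in> E" by auto
  qed
  then show ?thesis by (rule matchableI)
qed

lemma matchable_Un:
  assumes "matchable E A" "matchable E B" "A \<inter> B = {}"
  shows "matchable E (A \<union> B)"
proof -
  have "matchable E (\<Union>b\<in>UNIV. if b then A else B)"
    using assms by (intro matchable_UN) (auto simp: disjoint_family_on_def)
  then show ?thesis by (simp add: UNIV_bool Un_commute)
qed

lemma matchable_insert2: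
  assumes "matchable E A" "{a, b} \<in> E" "a \<notin> A" "b \<notin> A" "a \<noteq> b"
  shows "matchable E (insert a (insert b A))"
  using assms mate_insert2 by (metis matchable_def)

lemma matching_of_mate:
  assumes "mate E A m"
  shows "(\<lambda>a. {a, m a}) ` A \<subseteq> E" "disjoint ((\<lambda>a. {a, m a}) ` A)" "\<Union>((\<lambda>a. {a, m a}) ` A) = A"
proof -
  show "(\<lambda>a. {a, m a}) ` A \<subseteq> E"
    using mateD(3)[OF assms] by blast
  show "\<Union>((\<lambda>a. {a, m a}) ` A) = A"
    using mateD(1)[OF assms] by blast
  show "disjoint ((\<lambda>a. {a, m a}) ` A)"
  proof (rule disjointI)
    fix d e assume "d \<in> (\<lambda>a. {a, m a}) ` A" "e \<in> (\<lambda>a. {a, m a}) ` A" "d \<noteq> e"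
    then obtain a b where ab: "a \<in> A" "b \<in> A" "d = {a, m a}" "e = {b, m b}" "{a, m a} \<noteq> {b, m b}"
      by blast
    note mm = mateD(2)[OF assms ab(1)] mateD(2)[OF assms ab(2)]
    have "a \<noteq> b" using ab(5) by blast
    moreover have "a \<noteq> m b" using ab(5) mm(2) by (metis insert_commute)
    moreover have "m a \<noteq> b" using ab(5) mm(1) by (metis insert_commute)
    moreover have "m a \<noteq> m b" using \<open>a \<noteq> b\<close> mm by metis
    ultimately show "d \<inter> e = {}" using ab(3,4) by blast
  qed
qed

lemma mate_of_matching:
  assumes "simple E" "M \<subseteq> E" "disjoint M" "\<Union>M = A"
  obtains m where "mate E A m" "\<And>a. a \<in> A \<Longrightarrow> {a, m a} \<in> M"
    "\<And>a b. {a, b} \<in> M \<Longrightarrow> m a = b"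
proof -
  have ex: "\<exists>b. {a, b} \<in> M" if a: "a \<in> A" for a
  proof -
    obtain e where e: "e \<in> M" "a \<in> e" using a assms(4) by auto
    then have "card e = 2" using assms(1,2) by (auto simp: simple_def)
    then show ?thesis using e by (auto simp: card_2_iff insert_commute)
  qed
  have uniq: "b = c" if "{a, b} \<in> M" "{a, c} \<in> M" for a b c
  proof -
    have "{a, b} = {a, c}"
      using disjointD[OF assms(3) that] by auto
    then show ?thesis by (auto simp: doubleton_eq_iff)
  qed
  define m where "m a = (SOME b. {a, b} \<in> M)" for a
  have m: "{a, m a} \<in> M" if "a \<in> A" for a
    using someI_ex[OF ex[OF that]] by (simp add: m_def)
  have mA: "m a \<in> A" if "a \<in> A" for a
    using m[OF that] assms(4) by auto
  have mm: "m (m a) = a" if "a \<in> A" for a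
    using uniq[OF m[OF mA[OF that]], of a] m[OF that] by (simp add: insert_commute)
  show thesis
  proof
    show "mate E A m" using m mA mm assms(2) by (auto simp: mate_def)
    show "{a, m a} \<in> M" if "a \<in> A" for a using m that .
    show "m a = b" if "{a, b} \<in> M" for a b
    proof -
      have "a \<in> A" using that assms(4) by blast
      from uniq[OF m[OF this] that] show ?thesis .
    qed
  qed
qed

lemma matchable_iff_matching:
  assumes "simple E"
  shows "matchable E A \<longleftrightarrow> (\<exists>M\<subseteq>E. disjoint M \<and> \<Union>M = A)"
proof
  assume "matchable E A"
  then obtain m where "mate E A m" by (auto simp: matchable_def)
  from matching_of_mate[OF this] show "\<exists>M\<subseteq>E. disjoint M \<and> \<Union>M = A" by blast
next
  assume "\<exists>M\<subseteq>E. disjoint M \<and> \<Union>M = A"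
  then obtain M where "M \<subseteq> E" "disjoint M" "\<Union>M = A" by blast
  from mate_of_matching[OF assms this] obtain m where "mate E A m" .
  then show "matchable E A" by (rule matchableI)
qed

lemma matching_card:
  assumes "simple E" "M \<subseteq> E" "disjoint M" "finite (\<Union>M)"
  shows "card (\<Union>M) = 2 * card M"
proof -
  have fin: "finite e" if "e \<in> M" for e using that assms(4) by (meson Union_upper finite_subset)
  have "card (\<Union>M) = (\<Sum>e\<in>M. card e)"
    by (rule card_Union_disjoint) (use assms(3) fin in \<open>auto simp: disjoint_def pairwise_def disjnt_def\<close>)
  also have "\<dots> = (\<Sum>e\<in>M. 2)"
    using assms(1,2) by (intro sum.cong) (auto simp: simple_def)
  finally show ?thesis by simp
qed

lemma matchable_even:
  assumes "simple E" "finite A" "matchable E A"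
  shows "even (card A)"
proof -
  obtain M where "M \<subseteq> E" "disjoint M" "\<Union>M = A"
    using assms(1,3) by (auto simp: matchable_iff_matching)
  with matching_card[OF assms(1), of M] assms(2) show ?thesis by simp
qed

lemma mate_even:
  assumes "simple E" "finite A" "mate E A m"
  shows "even (card A)"
  using matchable_even[OF assms(1,2) matchableI[OF assms(3)]] .

section \<open>Connected components of vertex sets and the count of odd ones\<close>

definition reach :: "'a set set \<Rightarrow> 'a set \<Rightarrow> ('a \<times> 'a) set" where
  "reach E A = {(u, v). {u, v} \<in> E \<and> u \<in> A \<and> v \<in> A}\<^sup>*"

text \<open>The edge set is a parameter, so that the same notion yields the components of
  \<open>G - X\<close> and, with the allowed edges, the factor-components.\<close>

definition comp_of :: "'a set set \<Rightarrow> 'a set \<Rightarrow> 'a \<Rightarrow> 'a set" where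
  "comp_of E A v = reach E A `` {v}"

definition comps :: "'a set set \<Rightarrow> 'a set \<Rightarrow> 'a set set" where
  "comps E A = comp_of E A ` A"

text \<open>These sets are the unions of components. Parity arguments only need that no edge leaves
  the set, so that the components themselves need not be identified.\<close>

definition closed_in :: "'a set set \<Rightarrow> 'a set \<Rightarrow> 'a set \<Rightarrow> bool" where
  "closed_in E A K \<longleftrightarrow> K \<subseteq> A \<and> (\<forall>u\<in>K. \<forall>v\<in>A. {u, v} \<in> E \<longrightarrow> v \<in> K)"

lemma comp_of_refl [simp]: "v \<in> comp_of E A v"
  by (simp add: comp_of_def reach_def)

lemma sym_reach: "sym (reach E A)"
  unfolding reach_def by (rule sym_rtrancl) (auto simp: sym_def insert_commute)

lemma comp_of_eq:
  assumes "u \<in> comp_of E A v"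
  shows "comp_of E A u = comp_of E A v"
proof -
  have "(v, u) \<in> reach E A" "(u, v) \<in> reach E A"
    using assms sym_reach[of E A] by (auto simp: comp_of_def sym_def)
  moreover have "trans (reach E A)" by (simp add: reach_def trans_rtrancl)
  ultimately show ?thesis by (auto simp: comp_of_def dest: transD)
qed

lemma comp_of_subset:
  assumes "closed_in E A T" "v \<in> T"
  shows "comp_of E A v \<subseteq> T"
proof
  fix u assume "u \<in> comp_of E A v"
  then have "(v, u) \<in> {(u, v). {u, v} \<in> E \<and> u \<in> A \<and> v \<in> A}\<^sup>*"
    by (simp add: comp_of_def reach_def)
  then show "u \<in> T"
    by induction (use assms in \<open>auto simp: closed_in_def\<close>)
qed

lemma comp_of_sub: "v \<in> A \<Longrightarrow> comp_of E A v \<subseteq> A"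
  by (rule comp_of_subset) (auto simp: closed_in_def)

lemma comp_of_step:
  assumes "u \<in> comp_of E A v" "{u, w} \<in> E" "u \<in> A" "w \<in> A"
  shows "w \<in> comp_of E A v"
  using assms unfolding comp_of_def reach_def by (auto intro: rtrancl_into_rtrancl)

lemma closed_comp_of: "v \<in> A \<Longrightarrow> closed_in E A (comp_of E A v)"
  using comp_of_sub[of v A E] by (auto simp: closed_in_def intro: comp_of_step)

lemma comps_eq: "K \<in> comps E A \<Longrightarrow> v \<in> K \<Longrightarrow> K = comp_of E A v"
  by (auto simp: comps_def dest: comp_of_eq)

lemma closed_comps: "K \<in> comps E A \<Longrightarrow> closed_in E A K"
  by (auto simp: comps_def intro: closed_comp_of)

lemma comps_nonempty: "K \<in> comps E A \<Longrightarrow> K \<noteq> {}"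
  by (auto simp: comps_def intro: comp_of_refl)

lemma comps_sub: "K \<in> comps E A \<Longrightarrow> K \<subseteq> A"
  using closed_comps by (auto simp: closed_in_def)

lemma comps_disjoint: "K \<in> comps E A \<Longrightarrow> K' \<in> comps E A \<Longrightarrow> v \<in> K \<Longrightarrow> v \<in> K' \<Longrightarrow> K = K'"
  by (metis comps_eq)

lemma comps_subset:
  assumes "K \<in> comps E A" "u \<in> K" "u \<in> T"
    "\<And>a b. a \<in> K \<Longrightarrow> b \<in> K \<Longrightarrow> a \<in> T \<Longrightarrow> {a, b} \<in> E \<Longrightarrow> b \<in> T"
  shows "K \<subseteq> T"
proof -
  have "closed_in E A (K \<inter> T)"
    using closed_comps[OF assms(1)] assms(4) unfolding closed_in_def by blast
  from comp_of_subset[OF this, of u] comps_eq[OF assms(1,2)] assms(2,3) show ?thesis by auto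
qed

lemma closed_UN_comps:
  assumes "closed_in E A K"
  shows "K = \<Union>{C \<in> comps E A. C \<subseteq> K}"
proof -
  have "comp_of E A v \<in> {C \<in> comps E A. C \<subseteq> K}" if "v \<in> K" for v
    using that assms comp_of_subset[OF assms that] by (auto simp: comps_def closed_in_def)
  then show ?thesis by (auto intro: comp_of_refl)
qed

definition odd_comps :: "'a set set \<Rightarrow> 'a set \<Rightarrow> 'a set set" where
  "odd_comps E A = {K \<in> comps E A. odd (card K)}"

lemma finite_odd_comps: "finite A \<Longrightarrow> finite (odd_comps E A)"
  by (simp add: odd_comps_def comps_def)

lemma odd_closed_contains_odd_comp:
  assumes "finite A" "closed_in E A K" "odd (card K)"
  obtains C where "C \<in> odd_comps E A" "C \<subseteq> K"
proof -
  have disj: "disjoint {C \<in> comps E A. C \<subseteq> K}"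
    using comps_disjoint[of _ E A] unfolding disjoint_def by blast
  have fin: "finite C" if "C \<in> {C \<in> comps E A. C \<subseteq> K}" for C
    using that comps_sub[of C E A] assms(1) finite_subset by blast
  have "\<exists>C\<in>{C \<in> comps E A. C \<subseteq> K}. odd (card C)"
  proof (rule ccontr)
    assume "\<not> ?thesis"
    moreover have "card K = (\<Sum>C\<in>{C \<in> comps E A. C \<subseteq> K}. card C)"
      using card_Union_disjoint[OF disj fin] closed_UN_comps[OF assms(2)] by simp
    ultimately have "even (card K)" by (simp only:, intro dvd_sum) blast
    with assms(3) show False by simp
  qed
  then show thesis using that by (auto simp: odd_comps_def)
qed

text \<open>Every odd closed set contains an odd component, and disjointness keeps the chosen
  components distinct. Lower bounds on the number of odd components can therefore be read off from
  closed sets.\<close>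

lemma card_odd_family_le:
  assumes "finite A" "disjoint F" "\<And>K. K \<in> F \<Longrightarrow> closed_in E A K \<and> odd (card K)"
  shows "card F \<le> card (odd_comps E A)"
proof -
  have "\<exists>c. \<forall>K\<in>F. c K \<in> odd_comps E A \<and> c K \<subseteq> K"
    using odd_closed_contains_odd_comp[OF assms(1)] assms(3) by (intro bchoice) metis
  then obtain c where c: "\<And>K. K \<in> F \<Longrightarrow> c K \<in> odd_comps E A \<and> c K \<subseteq> K" by blast
  have "inj_on c F"
  proof
    fix K L assume KL: "K \<in> F" "L \<in> F" "c K = c L"
    then have "c K \<noteq> {}" using c[OF KL(1)] comps_nonempty[of "c K" E A] by (simp add: odd_comps_def)
    then show "K = L" using c[OF KL(1)] c[OF KL(2)] KL assms(2) unfolding disjoint_def by blast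
  qed
  then show ?thesis
    using c finite_odd_comps[OF assms(1)] by (intro card_inj_on_le) auto
qed

text \<open>A matching that never led from \<open>K\<close> to \<open>Y\<close> would pair up the
  vertices of \<open>K\<close>, against parity.\<close>

lemma mate_leaves_odd:
  assumes "simple E" "mate E A m" "closed_in E (A - Y) K" "odd (card K)"
  shows "\<exists>k\<in>K. m k \<in> Y"
proof (rule ccontr)
  assume a: "\<not> ?thesis"
  have KA: "K \<subseteq> A" using assms(3) by (auto simp: closed_in_def)
  have "mate E K m"
  proof (rule mate_subset[OF assms(2) KA])
    fix b assume b: "b \<in> K"
    with KA have "b \<in> A" by blast
    note mb = mateD[OF assms(2) this]
    show "m b \<in> K" using mb a b assms(3) unfolding closed_in_def by blast
  qed
  moreover have "finite K" using assms(4) card.infinite by fastforce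
  ultimately have "even (card K)" using mate_even[OF assms(1)] by blast
  with assms(4) show False by simp
qed

text \<open>The easy half of Tutte's theorem: every odd component is matched to \<open>Y\<close> at
  least once, and distinct components use distinct partners.\<close>

lemma card_odd_comps_le:
  assumes "simple E" "finite A" "matchable E A" "Y \<subseteq> A"
  shows "card (odd_comps E (A - Y)) \<le> card Y"
proof -
  obtain m where m: "mate E A m" using assms(3) by (auto simp: matchable_def)
  have "\<exists>k\<in>K. m k \<in> Y" if "K \<in> odd_comps E (A - Y)" for K
    using mate_leaves_odd[OF assms(1) m closed_comps[of K]] that by (simp add: odd_comps_def)
  then obtain k where k: "\<And>K. K \<in> odd_comps E (A - Y) \<Longrightarrow> k K \<in> K \<and> m (k K) \<in> Y" by metis
  have "inj_on (\<lambda>K. m (k K)) (odd_comps E (A - Y))"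
  proof
    fix K L assume KL: "K \<in> odd_comps E (A - Y)" "L \<in> odd_comps E (A - Y)" "m (k K) = m (k L)"
    then have c: "K \<in> comps E (A - Y)" "L \<in> comps E (A - Y)" by (auto simp: odd_comps_def)
    have "k K \<in> A" "k L \<in> A" using k[OF KL(1)] k[OF KL(2)] comps_sub[OF c(1)] comps_sub[OF c(2)] by blast+
    then have "k K = k L" using mate_inj[OF m] KL(3) by blast
    then show "K = L" using comps_disjoint[OF c] k[OF KL(1)] k[OF KL(2)] by simp
  qed
  then show ?thesis
    using k finite_subset[OF assms(4,2)] by (intro card_inj_on_le) auto
qed

section \<open>Berge's formula and alternating paths\<close>

text \<open>The covered set stands for the matching, because the exchange arguments speak only of
  its size and of the vertices missed.\<close>

definition maximum :: "'a set set \<Rightarrow> 'a set \<Rightarrow> 'a set \<Rightarrow> bool" where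
  "maximum E A B \<longleftrightarrow> B \<subseteq> A \<and> matchable E B \<and> (\<forall>B'\<subseteq>A. matchable E B' \<longrightarrow> card B' \<le> card B)"

lemma maximum_card: "maximum E A B \<Longrightarrow> maximum E A C \<Longrightarrow> card B = card C"
  by (auto simp: maximum_def intro: antisym)

lemma maximum_maximal:
  assumes "finite A" "maximum E A B" "{a, b} \<in> E" "a \<in> A" "b \<in> A" "a \<noteq> b"
  shows "a \<in> B \<or> b \<in> B"
proof (rule ccontr)
  assume ab: "\<not> ?thesis"
  then have "matchable E (insert a (insert b B))"
    using assms(2,3,6) by (intro matchable_insert2) (auto simp: maximum_def)
  then have "card (insert a (insert b B)) \<le> card B"
    using assms(2,4,5) unfolding maximum_def by (metis insert_subset)
  moreover have "finite B" using assms(1,2) finite_subset by (auto simp: maximum_def)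
  ultimately show False using ab assms(6) by simp
qed

lemma ex_maximum:
  assumes "finite A"
  shows "\<exists>B. maximum E A B"
proof -
  have "\<exists>B. (B \<subseteq> A \<and> matchable E B) \<and> (\<forall>B'. B' \<subseteq> A \<and> matchable E B' \<longrightarrow> card B' \<le> card B)"
    by (rule ex_has_greatest_nat[of _ "{}" _ "Suc (card A)"]) (auto simp: less_Suc_eq_le intro: card_mono[OF assms])
  then show ?thesis by (auto simp: maximum_def)
qed

text \<open>Gallai's exchange argument: among the maximum matchings missing \<open>t\<close>, one that shares as many
  edges as possible with a maximum matching missing \<open>u\<close> and \<open>v\<close> cannot cover both \<open>u\<close> and \<open>v\<close>.\<close>

lemma gallai_exchange:
  assumes "simple E" "finite A" "maximum E A B" "u \<in> A - B" "v \<in> A - B" "u \<noteq> v"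
    and "maximum E A C0" "t \<notin> C0"
  shows "\<exists>C. maximum E A C \<and> t \<notin> C \<and> (u \<notin> C \<or> v \<notin> C)"
proof (rule ccontr)
  assume "\<not> ?thesis"
  then have uv: "u \<in> C" "v \<in> C" if "maximum E A C" "t \<notin> C" for C using that by blast+
  obtain m where m: "mate E B m" using assms(3) by (auto simp: maximum_def matchable_def)
  obtain n0 where n0: "mate E C0 n0" using assms(7) by (auto simp: maximum_def matchable_def)
  define P where "P = (\<lambda>(C, n). maximum E A C \<and> t \<notin> C \<and> mate E C n)"
  define f where "f = (\<lambda>(C, n). card {a \<in> B \<inter> C. m a = n a})"
  have finB: "finite B" using assms(2,3) finite_subset by (auto simp: maximum_def)
  have "\<exists>p. P p \<and> (\<forall>q. P q \<longrightarrow> f q \<le> f p)"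
  proof (rule ex_has_greatest_nat[of P "(C0, n0)" f "Suc (card B)"])
    show "P (C0, n0)" using assms(7,8) n0 by (simp add: P_def)
    show "\<forall>q. P q \<longrightarrow> f q < Suc (card B)"
      using finB by (auto simp: f_def less_Suc_eq_le intro!: card_mono)
  qed
  then obtain C n where C: "maximum E A C" "t \<notin> C" and n: "mate E C n"
    and max: "\<And>C' n'. maximum E A C' \<Longrightarrow> t \<notin> C' \<Longrightarrow> mate E C' n' \<Longrightarrow>
      card {a \<in> B \<inter> C'. m a = n' a} \<le> card {a \<in> B \<inter> C. m a = n a}"
    unfolding P_def f_def by fastforce
  have finC: "finite C" using assms(2) C finite_subset by (auto simp: maximum_def)
  have "card {u, v} \<le> card (C - B)"
    using uv[OF C] assms(4,5) finC by (intro card_mono) auto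
  moreover have "card (C - B) = card (B - C)"
    using card_le_sym_Diff[OF finB finC] card_le_sym_Diff[OF finC finB] maximum_card[OF assms(3) C(1)]
    by simp
  \<comment> \<open>Two vertices are wanted so that one of them differs from \<open>t\<close>. They
    are forced by \<open>u\<close> and \<open>v\<close>, which \<open>C\<close> covers and
    \<open>B\<close> misses, since \<open>B\<close> and \<open>C\<close> have equal size.\<close>
  ultimately have "card (B - C) \<ge> 2" using assms(6) by simp
  then have "\<not> B - C \<subseteq> {t}" using card_mono[of "{t}" "B - C"] by auto
  then obtain x where x: "x \<in> B" "x \<notin> C" "x \<noteq> t" by blast
  define y where "y = m x"
  have y: "y \<in> B" "m y = x" "{x, y} \<in> E" "x \<noteq> y"
    using mateD[OF m x(1)] mate_neq[OF assms(1) m x(1)] by (auto simp: y_def)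
  have BA: "B \<subseteq> A" using assms(3) by (simp add: maximum_def)
  have yC: "y \<in> C" using maximum_maximal[OF assms(2) C(1) y(3)] x y BA by blast
  define z where "z = n y"
  have z: "z \<in> C" "n z = y" "z \<noteq> y" using mateD[OF n yC] mate_neq[OF assms(1) n yC] by (auto simp: z_def)
  \<comment> \<open>The edge \<open>{y, z}\<close> of \<open>n\<close> is exchanged for the edge
    \<open>{x, y}\<close> of \<open>m\<close>. The size is kept, and \<open>t\<close> stays missed
    because \<open>x\<close> differs from \<open>t\<close>.\<close>
  define C' where "C' = insert x (C - {z})"
  define n' where "n' = n(x := y, y := x)"
  have n': "mate E C' n'"
    unfolding mate_def
  proof
    fix a assume a: "a \<in> C'"
    consider "a = x" | "a = y" | "a \<in> C" "a \<noteq> z" "a \<noteq> x" "a \<noteq> y" using a by (auto simp: C'_def)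
    then show "n' a \<in> C' \<and> n' (n' a) = a \<and> {a, n' a} \<in> E"
    proof cases
      case 1
      then show ?thesis using y yC z by (auto simp: n'_def C'_def)
    next
      case 2
      then show ?thesis using y yC z by (auto simp: n'_def C'_def insert_commute)
    next
      case 3
      note na = mateD[OF n 3(1)]
      have "n a \<noteq> z" using mate_inj[OF n 3(1) yC] 3 by (auto simp: z_def)
      moreover have "n a \<noteq> y" using na(2) 3 by (auto simp: z_def)
      moreover have "n a \<noteq> x" using na(1) x by blast
      ultimately show ?thesis using na 3 by (simp add: n'_def C'_def)
    qed
  qed
  have "card C' = Suc (card (C - {z}))" unfolding C'_def using finC x by (intro card_insert_disjoint) auto
  then have cC': "card C' = card C" using card_Suc_Diff1[OF finC z(1)] by (rule trans)
  have "maximum E A C'"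
    using C(1) cC' matchableI[OF n'] BA x by (auto simp: maximum_def C'_def)
  moreover have "t \<notin> C'" using C(2) x by (auto simp: C'_def)
  ultimately have le: "card {a \<in> B \<inter> C'. m a = n' a} \<le> card {a \<in> B \<inter> C. m a = n a}"
    using max n' by blast
  \<comment> \<open>No agreement is lost: agreement at \<open>y\<close> or at \<open>z\<close> would
    give \<open>x = z\<close> and put \<open>x\<close> into \<open>C\<close>. The vertex
    \<open>x\<close> is a new point of agreement.\<close>
  have "{a \<in> B \<inter> C. m a = n a} \<subseteq> {a \<in> B \<inter> C'. m a = n' a}"
  proof
    fix a assume a: "a \<in> {a \<in> B \<inter> C. m a = n a}"
    have "a \<noteq> y" using a y z x by (auto simp: z_def)
    moreover have "a \<noteq> x" using a x by blast
    moreover have "a \<noteq> z" using a z y mateD(2)[OF m, of a] x by auto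
    ultimately show "a \<in> {a \<in> B \<inter> C'. m a = n' a}" using a by (simp add: C'_def n'_def)
  qed
  moreover have "x \<in> {a \<in> B \<inter> C'. m a = n' a}" using x y by (auto simp: C'_def n'_def y_def)
  ultimately have "{a \<in> B \<inter> C. m a = n a} \<subset> {a \<in> B \<inter> C'. m a = n' a}" using x by blast
  then have "card {a \<in> B \<inter> C. m a = n a} < card {a \<in> B \<inter> C'. m a = n' a}"
    using finB by (intro psubset_card_mono) auto
  with le show False by simp
qed

text \<open>The hard half of Berge's formula. If some vertex lies in every maximum matching, it is
  removed and put into \<open>Y\<close>. Otherwise Gallai's argument shows that a maximum matching
  misses at most one vertex of each component; then \<open>Y = {}\<close> works, and
  \<open>F\<close> consists of the components with a missed vertex.\<close>

lemma berge:
  assumes "simple E" "finite A"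
  shows "\<exists>B Y F. B \<subseteq> A \<and> matchable E B \<and> Y \<subseteq> A \<and> disjoint F \<and>
    (\<forall>K\<in>F. closed_in E (A - Y) K \<and> odd (card K)) \<and> card A + card Y \<le> card F + card B"
  using assms(2)
proof (induction A rule: finite_psubset_induct)
  case (psubset A)
  obtain B where B: "maximum E A B" using ex_maximum[OF psubset.hyps] by blast
  have finB: "finite B" and BA: "B \<subseteq> A" and mB: "matchable E B"
    using psubset.hyps B finite_subset by (auto simp: maximum_def)
  show ?case
  proof (cases "\<exists>v\<in>A. \<forall>C. maximum E A C \<longrightarrow> v \<in> C")
    case True
    then obtain v where v: "v \<in> A" "\<And>C. maximum E A C \<Longrightarrow> v \<in> C" by blast
    have "A - {v} \<subset> A" using v(1) by blast
    from psubset.IH[OF this] obtain B' Y F where IH: "B' \<subseteq> A - {v}" "matchable E B'" "Y \<subseteq> A - {v}" "disjoint F"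
      "\<forall>K\<in>F. closed_in E (A - {v} - Y) K \<and> odd (card K)" "card (A - {v}) + card Y \<le> card F + card B'"
      by blast
    have "card B' \<le> card B" using IH(1,2) B by (auto simp: maximum_def)
    moreover have "card B' \<noteq> card B"
    proof
      assume "card B' = card B"
      then have "maximum E A B'" using IH(1,2) B unfolding maximum_def by auto
      from v(2)[OF this] IH(1) show False by blast
    qed
    moreover have finB': "finite B'" by (rule finite_subset[OF IH(1)]) (simp add: psubset.hyps)
    have "even (card B)" "even (card B')"
      by (rule matchable_even[OF assms(1) finB mB], rule matchable_even[OF assms(1) finB' IH(2)])
    \<comment> \<open>\<open>B'\<close> misses \<open>v\<close> and so is not maximum in
      \<open>A\<close>. Since both sizes are even the gap is at least two, which pays for
      \<open>v\<close> on the left-hand side, once in \<open>A\<close> and once in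
      \<open>Y\<close>.\<close>
    ultimately have "card B' + 2 \<le> card B" by presburger
    moreover have "card A = Suc (card (A - {v}))" using card_Suc_Diff1[OF psubset.hyps v(1)] by (rule sym)
    moreover have "card (insert v Y) = Suc (card Y)"
      using IH(3) psubset.hyps finite_subset[of Y A] by (subst card_insert_disjoint) auto
    ultimately have "card A + card (insert v Y) \<le> card F + card B" using IH(6) by simp
    moreover have "A - insert v Y = A - {v} - Y" by blast
    moreover have "insert v Y \<subseteq> A" using IH(3) v(1) by blast
    ultimately show ?thesis using BA mB IH(4,5) by metis
  next
    case False
    then have miss: "\<exists>C. maximum E A C \<and> v \<notin> C" if "v \<in> A" for v using that by blast
    \<comment> \<open>Adjacent vertices are related, since a maximum matching cannot miss both ends
      of an edge. Transitivity is Gallai's exchange, applied with a maximum matching that misses the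
      middle vertex.\<close>
    define R where "R u v \<longleftrightarrow> u = v \<or> (\<forall>C. maximum E A C \<longrightarrow> u \<in> C \<or> v \<in> C)" for u v
    have R_trans: "R u w" if R: "R u v" "R v w" "u \<in> A" "v \<in> A" "w \<in> A" for u v w
    proof (rule ccontr)
      assume n: "\<not> R u w"
      then obtain C where C: "maximum E A C" "u \<in> A - C" "w \<in> A - C" "u \<noteq> w"
        using R(3,5) by (auto simp: R_def)
      obtain C0 where C0: "maximum E A C0" "v \<notin> C0" using miss[OF R(4)] by blast
      from gallai_exchange[OF assms(1) psubset.hyps C C0] R(1,2) n
      show False unfolding R_def by auto
    qed
    have R_comp: "R v u" if v: "v \<in> A" and u: "u \<in> comp_of E A v" for u v
    proof -
      have "closed_in E A {u \<in> A. R v u}"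
        unfolding closed_in_def
      proof (intro conjI ballI impI)
        fix a b assume a: "a \<in> {u \<in> A. R v u}" and b: "b \<in> A" "{a, b} \<in> E"
        have "R a b"
          using maximum_maximal[OF psubset.hyps _ b(2) _ b(1) simple_neq[OF assms(1) b(2)]] a
          by (auto simp: R_def)
        with R_trans[of v a b] a b v show "b \<in> {u \<in> A. R v u}" by simp
      qed auto
      from comp_of_subset[OF this, of v] u v show ?thesis by (auto simp: R_def)
    qed
    have only: "u = v" if "v \<in> A - B" "u \<in> A - B" "u \<in> comp_of E A v" for u v
      using R_comp[of v u] that B by (auto simp: R_def)
    obtain m where m: "mate E B m" using mB by (auto simp: matchable_def)
    define F where "F = comp_of E A ` (A - B)"
    have "inj_on (comp_of E A) (A - B)"
    proof
      fix u v assume "u \<in> A - B" "v \<in> A - B" "comp_of E A u = comp_of E A v"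
      then show "u = v" using only[of v u] comp_of_refl[of u E A] by simp
    qed
    then have "card F = card (A - B)" by (simp add: F_def card_image)
    moreover have "card (A - B) = card A - card B" "card B \<le> card A"
      using BA psubset.hyps finB by (simp_all add: card_Diff_subset card_mono)
    ultimately have "card A + card {} \<le> card F + card B" by simp
    moreover have "disjoint F"
      unfolding F_def disjoint_def using comps_disjoint[of _ E A] by (auto simp: comps_def)
    moreover have "closed_in E (A - {}) K \<and> odd (card K)" if KF: "K \<in> F" for K
    proof -
      obtain v where v: "v \<in> A - B" "K = comp_of E A v" using KF by (auto simp: F_def)
      have K: "closed_in E A K" using closed_comp_of[of v A E] v by simp
      have KA: "K \<subseteq> A" using K by (simp add: closed_in_def)
      have KB: "K - {v} \<subseteq> B" using only[OF v(1)] v(2) KA by blast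
      have "mate E (K - {v}) m"
      proof (rule mate_subset[OF m KB])
        fix b assume b: "b \<in> K - {v}"
        then have "b \<in> B" using KB by blast
        note mb = mateD[OF m this]
        then have "m b \<in> K" using K b BA unfolding closed_in_def by blast
        then show "m b \<in> K - {v}" using mb v by blast
      qed
      then have "even (card (K - {v}))"
        by (rule mate_even[OF assms(1) finite_Diff[OF finite_subset[OF KA psubset.hyps]]])
      moreover have "v \<in> K" using v by simp
      ultimately have "odd (card K)"
        using card_Suc_Diff1[OF finite_subset[OF KA psubset.hyps], of v] by presburger
      with K show ?thesis by simp
    qed
    ultimately show ?thesis using BA mB
      by (intro exI[of _ B] exI[of _ "{}"] exI[of _ F]) auto
  qed
qed

text \<open>Follow the alternating path that starts at \<open>v\<close> with an edge of \<open>m\<close>, until it leaves \<open>A\<close>.\<close>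

lemma alternating_exit:
  assumes "simple E" "finite A" "mate E A m" "v \<in> A" "mate E B l" "A - {v} \<subseteq> B" "v \<notin> B"
  shows "\<exists>w\<in>A - {v}. l w \<notin> A \<and> matchable E (A - {v, w})"
  using assms(2-)
proof (induction A arbitrary: v B rule: finite_psubset_induct)
  case (psubset A)
  define u where "u = m v"
  have u: "u \<in> A" "m u = v" "{v, u} \<in> E" "u \<noteq> v"
    using mateD[OF psubset.prems(1,2)] mate_neq[OF assms(1) psubset.prems(1,2)] by (auto simp: u_def)
  have mA: "mate E (A - {v, u}) m"
  proof (rule mate_subset[OF psubset.prems(1)])
    fix b assume b: "b \<in> A - {v, u}"
    then show "m b \<in> A - {v, u}"
      using mateD[OF psubset.prems(1), of b] u by (auto simp: u_def)
  qed auto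
  have uB: "u \<in> B" using u psubset.prems by blast
  note lu = mateD[OF psubset.prems(3) uB] mate_neq[OF assms(1) psubset.prems(3) uB]
  show ?case
  proof (cases "l u \<in> A")
    case False
    then show ?thesis using u matchableI[OF mA] by blast
  next
    case True
    define v' where "v' = l u"
    have v': "v' \<in> A" "v' \<noteq> u" "v' \<noteq> v" using True lu psubset.prems(5) by (auto simp: v'_def)
    have "mate E (B - {u, v'}) l"
    proof (rule mate_subset[OF psubset.prems(3)])
      fix b assume b: "b \<in> B - {u, v'}"
      then show "l b \<in> B - {u, v'}"
        using mateD[OF psubset.prems(3), of b] lu by (auto simp: v'_def)
    qed auto
    \<comment> \<open>The path continues from \<open>v'\<close>: the edges \<open>{v, u}\<close> of
      \<open>m\<close> and \<open>{u, v'}\<close> of \<open>l\<close> are dropped, after which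
      \<open>l\<close> misses \<open>v'\<close> just as it missed \<open>v\<close> before.\<close>
    from psubset.IH[of "A - {v, u}", OF _ mA _ this] u v' psubset.prems
    obtain w where w: "w \<in> A - {v, u} - {v'}" "l w \<notin> A - {v, u}" "matchable E (A - {v, u} - {v', w})"
      by blast
    have wB: "w \<in> B" using w psubset.prems by blast
    have "l w \<noteq> v" using mateD(1)[OF psubset.prems(3) wB] psubset.prems(5) by blast
    moreover have "l w \<noteq> u" using mateD(2)[OF psubset.prems(3) wB] w by (auto simp: v'_def)
    ultimately have "l w \<notin> A" using w by blast
    moreover have "matchable E (A - {v, w})"
    proof -
      have "A - {v, w} = insert u (insert v' (A - {v, u} - {v', w}))" using u v' w by blast
      then show ?thesis
        using matchable_insert2[OF w(3), of u v'] lu(3) v'(2) by (simp add: v'_def)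
    qed
    ultimately show ?thesis using w by blast
  qed
qed

section \<open>Graphs in terms of edge and vertex sets\<close>

lemma fin_graph_simple: "fin_graph G \<Longrightarrow> simple (edges G)"
  by (simp add: fin_graph_def simple_def)

lemma fin_graph_edge: "fin_graph G \<Longrightarrow> {a, b} \<in> edges G \<Longrightarrow> a \<in> verts G \<and> b \<in> verts G"
  by (auto simp: fin_graph_def)

lemma verts_induced [simp]: "verts (induced G A) = verts G \<inter> A"
  by (simp add: induced_def)

lemma components_eq:
  assumes "\<And>u v. {u, v} \<in> edges G \<Longrightarrow> u \<in> verts G \<and> v \<in> verts G"
  shows "components G = comps (edges G) (verts G)"
proof -
  have "adj G = {(u, v). {u, v} \<in> edges G \<and> u \<in> verts G \<and> v \<in> verts G}"
    using assms by (auto simp: adj_def)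
  then show ?thesis
    by (auto simp: components_def comps_def comp_of_def reach_def quotient_def)
qed

lemma components_induced:
  assumes "A \<subseteq> verts G"
  shows "components (induced G A) = comps (edges G) A"
proof -
  have "adj (induced G A) = {(u, v). {u, v} \<in> edges G \<and> u \<in> A \<and> v \<in> A}"
    by (auto simp: adj_def induced_def)
  then show ?thesis
    using assms by (auto simp: components_def comps_def comp_of_def reach_def quotient_def Int_absorb1)
qed

lemma odd_components_eq: "odd_components G X = odd_comps (edges G) (verts G - X)"
  by (simp add: odd_components_def delete_def components_induced odd_comps_def)

lemma factorizable_induced:
  assumes "fin_graph G" "A \<subseteq> verts G"
  shows "factorizable (induced G A) \<longleftrightarrow> matchable (edges G) A"
  using assms(2)
  unfolding matchable_iff_matching[OF fin_graph_simple[OF assms(1)]]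
  by (auto simp: factorizable_def perfect_matching_def matching_def induced_def Int_absorb1)

lemma factorizable_delete:
  assumes "fin_graph G"
  shows "factorizable (delete G B) \<longleftrightarrow> matchable (edges G) (verts G - B)"
  unfolding delete_def by (rule factorizable_induced[OF assms]) auto

lemma factorizable_iff:
  assumes "fin_graph G"
  shows "factorizable G \<longleftrightarrow> matchable (edges G) (verts G)"
  unfolding matchable_iff_matching[OF fin_graph_simple[OF assms(1)]]
  by (auto simp: factorizable_def perfect_matching_def matching_def)

lemma allowed_edges_iff:
  assumes "fin_graph G"
  shows "{a, b} \<in> allowed_edges G \<longleftrightarrow> (\<exists>m. mate (edges G) (verts G) m \<and> a \<in> verts G \<and> m a = b)"
proof
  assume "{a, b} \<in> allowed_edges G"
  then obtain M where M: "{a, b} \<in> edges G" "M \<subseteq> edges G" "disjoint M" "\<Union>M = verts G" "{a, b} \<in> M"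
    by (auto simp: allowed_edges_def perfect_matching_def matching_def)
  obtain m where "mate (edges G) (verts G) m" "\<And>a b. {a, b} \<in> M \<Longrightarrow> m a = b"
    using mate_of_matching[OF fin_graph_simple[OF assms] M(2-4)] by metis
  with M(1,5) fin_graph_edge[OF assms] show "\<exists>m. mate (edges G) (verts G) m \<and> a \<in> verts G \<and> m a = b"
    by blast
next
  assume "\<exists>m. mate (edges G) (verts G) m \<and> a \<in> verts G \<and> m a = b"
  then obtain m where m: "mate (edges G) (verts G) m" "a \<in> verts G" "m a = b" by blast
  have "perfect_matching G ((\<lambda>a. {a, m a}) ` verts G)"
    using matching_of_mate[OF m(1)] by (simp add: perfect_matching_def matching_def)
  then show "{a, b} \<in> allowed_edges G"
    using mateD(3)[OF m(1,2)] m(2,3) by (auto simp: allowed_edges_def)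
qed

lemma allowed_edges_subset: "allowed_edges G \<subseteq> edges G"
  by (auto simp: allowed_edges_def)

text \<open>A perfect matching consists of allowed edges, so the allowed subgraph spans all vertices
  and every vertex has a factor-component.\<close>

lemma factor_components_eq:
  assumes "fin_graph G" "factorizable G"
  shows "factor_components G = induced G ` comps (allowed_edges G) (verts G)"
proof -
  obtain M where M: "perfect_matching G M" using assms(2) by (auto simp: factorizable_def)
  then have "M \<subseteq> allowed_edges G"
    by (auto simp: allowed_edges_def perfect_matching_def matching_def)
  then have "verts G \<subseteq> \<Union>(allowed_edges G)" using M unfolding perfect_matching_def by blast
  moreover have "\<Union>(allowed_edges G) \<subseteq> verts G"
    using assms(1) by (auto simp: allowed_edges_def fin_graph_def)
  ultimately have "verts (allowed_subgraph G) = verts G" by (simp add: allowed_subgraph_def)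
  moreover have "edges (allowed_subgraph G) = allowed_edges G" by (simp add: allowed_subgraph_def)
  ultimately have "components (allowed_subgraph G) = comps (allowed_edges G) (verts G)"
    using components_eq[of "allowed_subgraph G"] fin_graph_edge[OF assms(1)] allowed_edges_subset[of G]
    by (metis subsetD)
  then show ?thesis by (simp add: factor_components_def)
qed

lemma matching_number_factorizable:
  assumes "fin_graph G" "factorizable G"
  shows "card (verts G) = 2 * matching_number G"
proof -
  note simp = fin_graph_simple[OF assms(1)]
  have fin: "finite (verts G)" using assms(1) by (simp add: fin_graph_def)
  have U: "\<Union>M \<subseteq> verts G" if "matching G M" for M
    using that assms(1) by (auto simp: matching_def fin_graph_def)
  have two: "card (\<Union>M) = 2 * card M" if "matching G M" for M
    using that finite_subset[OF U[OF that] fin] by (intro matching_card[OF simp]) (auto simp: matching_def)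
  have le: "2 * card M \<le> card (verts G)" if "matching G M" for M
    using two[OF that] card_mono[OF fin U[OF that]] by simp
  obtain M0 where M0: "matching G M0" "\<Union>M0 = verts G"
    using assms(2) by (auto simp: factorizable_def perfect_matching_def)
  have "Max {card M |M. matching G M} = card M0"
  proof (rule Max_eqI)
    show "finite {card M |M. matching G M}"
      by (rule finite_subset[of _ "{..card (verts G)}"]) (use le in force)+
    show "y \<le> card M0" if "y \<in> {card M |M. matching G M}" for y
      using that le two[OF M0(1)] M0(2) by fastforce
  qed (use M0 in auto)
  then show ?thesis using two[OF M0(1)] M0(2) by (simp add: matching_number_def)
qed

text \<open>The right-hand side of the barrier equation vanishes for a factorizable graph.\<close>

lemma barrier_iff:
  assumes "fin_graph G" "factorizable G"
  shows "barrier G X \<longleftrightarrow> X \<subseteq> verts G \<and> card (odd_comps (edges G) (verts G - X)) = card X"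
  using matching_number_factorizable[OF assms] by (auto simp: barrier_def odd_components_eq)

section \<open>Matchings in a contracted graph\<close>

lemma verts_contract:
  assumes "W \<subseteq> Z" "Z \<subseteq> verts G" "W \<noteq> {}"
  shows "verts (contract (induced G Z) W) = insert None (Some ` (Z - W))"
  using assms by (auto simp: contract_def Let_def image_iff)

lemma edges_contract:
  assumes "fin_graph G" "W \<subseteq> Z"
  shows "{Some a, Some b} \<in> edges (contract (induced G Z) W) \<longleftrightarrow>
      {a, b} \<in> edges G \<and> a \<in> Z - W \<and> b \<in> Z - W" (is ?A)
    and "{None, Some w} \<in> edges (contract (induced G Z) W) \<longleftrightarrow>
      w \<in> Z - W \<and> (\<exists>h\<in>W. {w, h} \<in> edges G)" (is ?B)
    and "simple (edges (contract (induced G Z) W))"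
proof -
  let ?f = "\<lambda>v. if v \<in> W then None else Some v"
  let ?H = "contract (induced G Z) W"
  have HE: "edges ?H = {?f ` d |d. d \<in> {d \<in> edges G. d \<subseteq> Z} \<and> \<not> d \<subseteq> W}"
    by (simp add: contract_def induced_def Let_def)
  \<comment> \<open>Every surviving edge has an end outside \<open>W\<close>, which is listed first;
    the other end may become the contracted vertex.\<close>
  have H: "e \<in> edges ?H \<longleftrightarrow> (\<exists>a b. {a, b} \<in> edges G \<and> a \<noteq> b \<and> a \<in> Z - W \<and> b \<in> Z \<and> e = {Some a, ?f b})" for e
  proof
    assume "e \<in> edges ?H"
    then obtain d where d: "d \<in> edges G" "d \<subseteq> Z" "\<not> d \<subseteq> W" "e = ?f ` d"
      unfolding HE by blast
    then have "card d = 2" using fin_graph_simple[OF assms(1)] by (auto simp: simple_def)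
    moreover obtain a where a: "a \<in> d" "a \<notin> W" using d(3) by blast
    ultimately obtain b where b: "d = {a, b}" "a \<noteq> b" by (auto simp: card_2_iff)
    have "e = {Some a, ?f b}" using d(4) a(2) b(1) by simp
    moreover have "{a, b} \<in> edges G" "a \<in> Z - W" "b \<in> Z" using d(1,2) a(2) b(1) by blast+
    ultimately show "\<exists>a b. {a, b} \<in> edges G \<and> a \<noteq> b \<and> a \<in> Z - W \<and> b \<in> Z \<and> e = {Some a, ?f b}"
      using b(2) by metis
  next
    assume "\<exists>a b. {a, b} \<in> edges G \<and> a \<noteq> b \<and> a \<in> Z - W \<and> b \<in> Z \<and> e = {Some a, ?f b}"
    then obtain a b where ab: "{a, b} \<in> edges G" "a \<in> Z - W" "b \<in> Z" "e = {Some a, ?f b}" by blast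
    then have "e = ?f ` {a, b}" by simp
    moreover have "{a, b} \<in> {d \<in> edges G. d \<subseteq> Z}" "\<not> {a, b} \<subseteq> W" using ab assms(2) by auto
    ultimately show "e \<in> edges ?H" unfolding HE by blast
  qed
  show ?A
  proof
    assume "{Some a, Some b} \<in> edges ?H"
    then show "{a, b} \<in> edges G \<and> a \<in> Z - W \<and> b \<in> Z - W"
      unfolding H by (auto simp: doubleton_eq_iff insert_commute split: if_splits)
  next
    assume ab: "{a, b} \<in> edges G \<and> a \<in> Z - W \<and> b \<in> Z - W"
    moreover have "a \<noteq> b" using ab simple_neq[OF fin_graph_simple[OF assms(1)]] by blast
    ultimately show "{Some a, Some b} \<in> edges ?H"
      unfolding H by (intro exI[of _ a] exI[of _ b]) simp
  qed
  show ?B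
    unfolding H using simple_neq[OF fin_graph_simple[OF assms(1)]] assms(2)
    by (fastforce simp: doubleton_eq_iff insert_commute split: if_splits)
  show "simple (edges ?H)"
    unfolding simple_def by (auto simp: H card_insert_if)
qed

lemma fin_graph_contract:
  assumes "fin_graph G" "W \<subseteq> Z" "Z \<subseteq> verts G" "W \<noteq> {}"
  shows "fin_graph (contract (induced G Z) W)"
proof -
  have "finite (verts (contract (induced G Z) W))"
    using assms finite_subset[of Z "verts G"] by (simp add: verts_contract fin_graph_def)
  moreover have "e \<subseteq> verts (contract (induced G Z) W)" if e: "e \<in> edges (contract (induced G Z) W)" for e
  proof -
    obtain d where d: "e = (\<lambda>v. if v \<in> W then None else Some v) ` d" "d \<subseteq> verts G \<inter> Z"
      using e assms(1) unfolding contract_def induced_def Let_def fin_graph_def by auto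
    show ?thesis
      unfolding contract_def Let_def d(1) using d(2) by auto
  qed
  ultimately show ?thesis
    using edges_contract(3)[OF assms(1,2)] by (auto simp: fin_graph_def simple_def)
qed

lemma matchable_contract:
  assumes "fin_graph G" "W \<subseteq> Z" "A \<subseteq> Z - W" "matchable (edges G) A"
  shows "matchable (edges (contract (induced G Z) W)) (Some ` A)"
proof -
  obtain m where m: "mate (edges G) A m" using assms(4) by (auto simp: matchable_def)
  have "mate (edges (contract (induced G Z) W)) (Some ` A) (map_option m)"
    using mateD[OF m] assms(3) by (auto simp: mate_def edges_contract[OF assms(1,2)])
  then show ?thesis by (rule matchableI)
qed

text \<open>Factor-criticality of the contraction is expressed by matchings in \<open>G\<close>
  itself: when \<open>v\<close> is deleted, the contracted vertex takes a partner \<open>w\<close>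
  that has a neighbour in \<open>W\<close>, and the rest is matched outside \<open>W\<close>. The
  converse is \<open>factor_critical_contractD\<close>.\<close>

lemma factor_critical_contractI:
  assumes "fin_graph G" "W \<subseteq> Z" "Z \<subseteq> verts G" "W \<noteq> {}" "matchable (edges G) (Z - W)"
    and "\<And>v. v \<in> Z - W \<Longrightarrow> \<exists>w\<in>Z - W - {v}. \<exists>h\<in>W. {w, h} \<in> edges G \<and> matchable (edges G) (Z - W - {v, w})"
  shows "factor_critical (contract (induced G Z) W)"
  unfolding factor_critical_def
proof (intro ballI disjI2)
  let ?H = "contract (induced G Z) W"
  fix q assume "q \<in> verts ?H"
  then consider "q = None" | v where "v \<in> Z - W" "q = Some v"
    by (auto simp: verts_contract[OF assms(2-4)])
  then have "matchable (edges ?H) (verts ?H - {q})"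
  proof cases
    case 1
    then have "verts ?H - {q} = Some ` (Z - W)" by (auto simp: verts_contract[OF assms(2-4)])
    then show ?thesis using matchable_contract[OF assms(1,2) order_refl assms(5)] by simp
  next
    case 2
    from assms(6)[OF 2(1)] obtain w h where w: "w \<in> Z - W - {v}" "h \<in> W" "{w, h} \<in> edges G"
      "matchable (edges G) (Z - W - {v, w})" by blast
    have "{None, Some w} \<in> edges ?H" using w edges_contract(2)[OF assms(1,2)] by blast
    from matchable_insert2[OF matchable_contract[OF assms(1,2) _ w(4)] this]
    have "matchable (edges ?H) (insert None (insert (Some w) (Some ` (Z - W - {v, w}))))" by blast
    moreover have "insert None (insert (Some w) (Some ` (Z - W - {v, w}))) = verts ?H - {q}"
      using w 2 by (auto simp: verts_contract[OF assms(2-4)])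
    ultimately show ?thesis by simp
  qed
  then show "factorizable (delete ?H {q})"
    using factorizable_delete[OF fin_graph_contract[OF assms(1-4)]] by blast
qed

lemma factor_critical_contractD:
  assumes "fin_graph G" "W \<subseteq> Z" "Z \<subseteq> verts G" "W \<noteq> {}" "factor_critical (contract (induced G Z) W)"
    and v: "v \<in> Z - W"
  shows "\<exists>w\<in>Z - W - {v}. \<exists>h\<in>W. {w, h} \<in> edges G \<and> matchable (edges G) (Z - W - {v, w})"
proof -
  let ?H = "contract (induced G Z) W"
  have "Some v \<in> verts ?H" using v by (simp add: verts_contract[OF assms(2-4)])
  moreover have "verts (delete ?H {Some v}) \<noteq> {}"
    by (auto simp: delete_def verts_contract[OF assms(2-4)])
  ultimately have "matchable (edges ?H) (verts ?H - {Some v})"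
    using assms(5) factorizable_delete[OF fin_graph_contract[OF assms(1-4)]]
    unfolding factor_critical_def by blast
  moreover have "verts ?H - {Some v} = insert None (Some ` (Z - W - {v}))"
    by (auto simp: verts_contract[OF assms(2-4)])
  ultimately obtain m where m: "mate (edges ?H) (insert None (Some ` (Z - W - {v}))) m"
    by (auto simp: matchable_def)
  note mN = mateD[OF m, of None, simplified]
  have "m None \<noteq> None" by (rule mate_neq[OF edges_contract(3)[OF assms(1,2)] m]) simp
  with mN(1) have "m None \<in> Some ` (Z - W - {v})" by simp
  then obtain w where w: "m None = Some w" "w \<in> Z - W - {v}" by (rule imageE)
  obtain h where h: "h \<in> W" "{w, h} \<in> edges G"
    using mN(3) edges_contract(2)[OF assms(1,2)] unfolding w(1) by blast
  \<comment> \<open>On the vertices considered \<open>the\<close> never meets \<open>None\<close>,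
    because the contracted vertex already has the partner \<open>w\<close>.\<close>
  define n where "n a = the (m (Some a))" for a
  have n: "m (Some a) = Some (n a) \<and> n a \<in> Z - W - {v, w}" if a: "a \<in> Z - W - {v, w}" for a
  proof -
    have aA: "Some a \<in> insert None (Some ` (Z - W - {v}))" using a by blast
    note ma = mateD(1,2)[OF m aA]
    obtain b where b: "m (Some a) = Some b" using ma(2) w(1) a by (cases "m (Some a)") auto
    have "b \<noteq> w" using ma(2) w mN(2) b by force
    then show ?thesis using ma(1) b by (auto simp: n_def)
  qed
  have "mate (edges G) (Z - W - {v, w}) n"
    unfolding mate_def
  proof
    fix a assume a: "a \<in> Z - W - {v, w}"
    then have aA: "Some a \<in> insert None (Some ` (Z - W - {v}))" by blast
    have "{Some a, Some (n a)} \<in> edges ?H" using mateD(3)[OF m aA] n[OF a] by simp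
    moreover have "m (Some (n a)) = Some a" using mateD(2)[OF m aA] n[OF a] by simp
    then have "n (n a) = a" by (simp add: n_def[of "n a"])
    ultimately show "n a \<in> Z - W - {v, w} \<and> n (n a) = a \<and> {a, n a} \<in> edges G"
      using n[OF a] edges_contract(1)[OF assms(1,2)] by blast
  qed
  then have "matchable (edges G) (Z - W - {v, w})" by (rule matchableI)
  then show ?thesis using w(2) h by blast
qed

section \<open>Odd-maximal barriers\<close>

locale odd_maximal =
  fixes G :: "'a graph" and X :: "'a set"
  assumes fin: "fin_graph G" and fact: "factorizable G" and omb: "odd_maximal_barrier G X"
begin

abbreviation "V \<equiv> verts G"
abbreviation "E \<equiv> edges G"
abbreviation "Al \<equiv> allowed_edges G"
abbreviation "OC \<equiv> odd_comps E (V - X)"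
text \<open>The vertex set of the factor-component of a vertex.\<close>

abbreviation "fc \<equiv> comp_of Al V"

lemma simp_E: "simple E" by (rule fin_graph_simple[OF fin])
lemma finV: "finite V" using fin by (simp add: fin_graph_def)
lemma XV: "X \<subseteq> V" and card_OC: "card OC = card X"
  using omb by (auto simp: odd_maximal_barrier_def barrier_iff[OF fin fact])
lemma finX: "finite X" using finite_subset[OF XV finV] .
lemma finOC: "finite OC" by (rule finite_odd_comps) (simp add: finV)

lemma OC_sub: "K \<in> OC \<Longrightarrow> v \<in> K \<Longrightarrow> v \<in> V \<and> v \<notin> X"
  using comps_sub by (fastforce simp: odd_comps_def)
lemma OC_odd: "K \<in> OC \<Longrightarrow> odd (card K)"
  by (simp add: odd_comps_def)
lemma OC_disj: "K \<in> OC \<Longrightarrow> L \<in> OC \<Longrightarrow> v \<in> K \<Longrightarrow> v \<in> L \<Longrightarrow> K = L"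
  using comps_disjoint by (fastforce simp: odd_comps_def)
lemma OC_closed: "K \<in> OC \<Longrightarrow> closed_in E (V - X) K"
  by (simp add: odd_comps_def closed_comps)
lemma OC_step: "K \<in> OC \<Longrightarrow> u \<in> K \<Longrightarrow> {u, v} \<in> E \<Longrightarrow> v \<in> K \<or> v \<in> X"
  using OC_closed fin_graph_edge[OF fin, of u v] unfolding closed_in_def by blast
lemma fin_OC: "K \<in> OC \<Longrightarrow> finite K"
  using OC_odd card.infinite by fastforce

lemma OC_exit: "mate E V m \<Longrightarrow> K \<in> OC \<Longrightarrow> \<exists>k\<in>K. m k \<in> X"
  using mate_leaves_odd[OF simp_E _ OC_closed OC_odd] .

text \<open>Each odd component sends a vertex into \<open>X\<close>, distinct components to distinct
  vertices. There are exactly \<open>card X\<close> of them, so this injection is onto: every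
  perfect matching matches \<open>X\<close> bijectively to the odd components.\<close>

lemma OC_matched:
  assumes m: "mate E V m"
  shows "x \<in> X \<Longrightarrow> \<exists>K\<in>OC. m x \<in> K"
    and "\<lbrakk>x \<in> X; x' \<in> X; K \<in> OC; m x \<in> K; m x' \<in> K\<rbrakk> \<Longrightarrow> x = x'"
proof -
  obtain k where k: "\<And>K. K \<in> OC \<Longrightarrow> k K \<in> K \<and> m (k K) \<in> X"
    using OC_exit[OF m] by metis
  have kV: "k K \<in> V" if "K \<in> OC" for K using k[OF that] OC_sub[OF that] by blast
  have "inj_on (\<lambda>K. m (k K)) OC"
  proof
    fix K L assume KL: "K \<in> OC" "L \<in> OC" "m (k K) = m (k L)"
    then have "k K = k L" using mate_inj[OF m kV kV] by blast
    then show "K = L" using OC_disj[OF KL(1,2)] k[OF KL(1)] k[OF KL(2)] by simp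
  qed
  then have "card ((\<lambda>K. m (k K)) ` OC) = card X" by (simp add: card_image card_OC)
  then have im: "(\<lambda>K. m (k K)) ` OC = X" using k finX by (intro card_subset_eq) auto
  have ex: "\<exists>K\<in>OC. x = m (k K) \<and> m x = k K" if x: "x \<in> X" for x
  proof -
    obtain K where K: "K \<in> OC" "x = m (k K)" using im x by blast
    then show ?thesis using mateD(2)[OF m kV[OF K(1)]] by auto
  qed
  show "\<exists>K\<in>OC. m x \<in> K" if "x \<in> X" using ex[OF that] k by metis
  have uniq: "x = m (k K)" if x: "x \<in> X" and K: "K \<in> OC" "m x \<in> K" for x K
  proof -
    obtain L where L: "L \<in> OC" "x = m (k L)" "m x = k L" using ex[OF x] by blast
    have "K = L" using OC_disj[OF K(1) L(1) K(2)] k[OF L(1)] L(3) by simp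
    with L show ?thesis by simp
  qed
  show "x = x'" if "x \<in> X" "x' \<in> X" "K \<in> OC" "m x \<in> K" "m x' \<in> K"
    using uniq[OF that(1,3,4)] uniq[OF that(2,3,5)] by simp
qed

text \<open>Otherwise Berge's formula, applied to \<open>K - {v}\<close>, yields a set
  \<open>Y\<close> whose removal creates so many odd pieces that \<open>X\<close>, \<open>v\<close>
  and \<open>Y\<close> together form a barrier, against odd-maximality.\<close>

lemma OC_factor_critical:
  assumes K: "K \<in> OC" and v: "v \<in> K"
  shows "matchable E (K - {v})"
proof (rule ccontr)
  assume n: "\<not> ?thesis"
  have finK: "finite (K - {v})" using fin_OC[OF K] by simp
  obtain B Y F where b: "B \<subseteq> K - {v}" "matchable E B" "Y \<subseteq> K - {v}" "disjoint F"
    "\<And>L. L \<in> F \<Longrightarrow> closed_in E (K - {v} - Y) L \<and> odd (card L)"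
    "card (K - {v}) + card Y \<le> card F + card B"
    using berge[OF simp_E finK] by blast
  have finB: "finite B" by (rule finite_subset[OF b(1) finK])
  have "B \<noteq> K - {v}" using b(2) n by blast
  then have "card B < card (K - {v})" using b(1) finK by (intro psubset_card_mono) auto
  moreover have "even (card B)" by (rule matchable_even[OF simp_E finB b(2)])
  moreover have "even (card (K - {v}))"
    using card_Suc_Diff1[OF fin_OC[OF K] v] OC_odd[OF K] by presburger
  \<comment> \<open>By parity the deficiency is at least two: one unit accounts for \<open>v\<close>
    joining the barrier, the other for the odd component \<open>K\<close> that gets lost.\<close>
  ultimately have "card B + 2 \<le> card (K - {v})" by presburger
  with b(6) have F: "card Y + 2 \<le> card F" by simp
  define Y' where "Y' = insert v Y"
  have finY: "finite Y" by (rule finite_subset[OF b(3) finK])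
  have Y': "Y' \<subseteq> K" "Y' \<noteq> {}" "card Y' = Suc (card Y)"
    using b(3) v finY by (auto simp: Y'_def card_insert_if)
  have KV: "K \<subseteq> V - X" using OC_sub[OF K] by blast
  have cXY: "card (X \<union> Y') = card X + card Y'"
    using KV Y'(1) finX finY by (intro card_Un_disjoint) (auto simp: Y'_def)
  have LK: "L \<subseteq> K" if "L \<in> F" for L using b(5)[OF that] by (auto simp: closed_in_def)
  have Lne: "L \<noteq> {}" if "L \<in> F" for L using b(5)[OF that] by auto
  have finF: "finite F" using LK fin_OC[OF K] by (intro finite_subset[of F "Pow K"]) auto
  have sep: "L \<inter> K' = {}" if "L \<in> F" "K' \<in> OC - {K}" for L K'
    using LK[OF that(1)] OC_disj[OF K, of K'] that(2) by blast
  have "F \<inter> (OC - {K}) = {}" using sep Lne by (metis disjoint_iff inf.idem)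
  then have "card (F \<union> (OC - {K})) = card F + card (OC - {K})"
    using finF finOC by (simp add: card_Un_disjoint)
  moreover have "card OC = Suc (card (OC - {K}))"
    using card_Suc_Diff1[OF finOC K] by simp
  ultimately have big: "card X + card Y' \<le> card (F \<union> (OC - {K}))" using F Y'(3) card_OC by simp
  have "card (F \<union> (OC - {K})) \<le> card (odd_comps E (V - (X \<union> Y')))"
  proof (rule card_odd_family_le)
    show "finite (V - (X \<union> Y'))" using finV by simp
    show "disjoint (F \<union> (OC - {K}))"
    proof (rule disjointI)
      fix L L' assume L: "L \<in> F \<union> (OC - {K})" "L' \<in> F \<union> (OC - {K})" "L \<noteq> L'"
      have "L \<inter> L' = {}" if "L \<in> OC - {K}" "L' \<in> OC - {K}" using OC_disj[of L L'] that L(3) by blast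
      moreover have "L \<inter> L' = {}" if "L \<in> F" "L' \<in> F" by (rule disjointD[OF b(4) that L(3)])
      ultimately show "L \<inter> L' = {}" using L(1,2) sep[of L L'] sep[of L' L] by blast
    qed
    fix L assume "L \<in> F \<union> (OC - {K})"
    then show "closed_in E (V - (X \<union> Y')) L \<and> odd (card L)"
    proof
      assume L: "L \<in> F"
      have "closed_in E (V - (X \<union> Y')) L"
        using b(5)[OF L] OC_closed[OF K] KV unfolding closed_in_def Y'_def by blast
      then show ?thesis using b(5)[OF L] by simp
    next
      assume L: "L \<in> OC - {K}"
      then have "L \<inter> K = {}" using OC_disj[OF K, of L] by blast
      then have "closed_in E (V - (X \<union> Y')) L"
        using OC_closed[of L] L Y'(1) unfolding closed_in_def by blast
      then show ?thesis using OC_odd[of L] L by simp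
    qed
  qed
  moreover have sub: "X \<union> Y' \<subseteq> V" using XV KV Y'(1) by blast
  \<comment> \<open>The reverse inequality is the easy half of Tutte's theorem.\<close>
  ultimately have "card (odd_comps E (V - (X \<union> Y'))) = card (X \<union> Y')"
    using big cXY card_odd_comps_le[OF simp_E finV _ sub] fact factorizable_iff[OF fin] by simp
  then have "barrier G (X \<union> Y')" using sub by (simp add: barrier_iff[OF fin fact])
  moreover have "Y' \<subseteq> odd_verts G X"
    using Y'(1) K by (auto simp: odd_verts_def odd_components_eq)
  ultimately show False using omb Y'(2) by (auto simp: odd_maximal_barrier_def)
qed

section \<open>Labelling of the odd components, and reachability along arcs\<close>

definition M where "M = (SOME m. mate E V m)"

lemma M: "mate E V M"
  unfolding M_def by (rule someI_ex[of "mate E V"]) (use fact in \<open>simp add: factorizable_iff[OF fin] matchable_def\<close>)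

text \<open>The labelling depends on \<open>M\<close>; any other perfect matching assigns the odd
  components to \<open>X\<close> up to a permutation.\<close>

definition oc where "oc x = comp_of E (V - X) (M x)"

lemma oc:
  assumes "x \<in> X"
  shows "oc x \<in> OC" "M x \<in> oc x"
proof -
  obtain K where K: "K \<in> OC" "M x \<in> K" using OC_matched(1)[OF M assms] by blast
  then have "K = oc x" using comps_eq[of K E "V - X" "M x"] by (simp add: odd_comps_def oc_def)
  with K show "oc x \<in> OC" "M x \<in> oc x" by auto
qed

lemma oc_surj: "K \<in> OC \<Longrightarrow> \<exists>x\<in>X. K = oc x"
proof -
  assume K: "K \<in> OC"
  obtain k where k: "k \<in> K" "M k \<in> X" using OC_exit[OF M K] by blast
  have "M (M k) = k" using mateD(2)[OF M] OC_sub[OF K k(1)] by blast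
  then have "K = oc (M k)" using OC_disj[OF K oc(1)[OF k(2)] k(1)] oc(2)[OF k(2)] by simp
  with k(2) show ?thesis by blast
qed

lemma oc_inj: "x \<in> X \<Longrightarrow> x' \<in> X \<Longrightarrow> v \<in> oc x \<Longrightarrow> v \<in> oc x' \<Longrightarrow> x = x'"
  using OC_disj[of "oc x" "oc x'" v] oc[of x] oc[of x'] OC_matched(2)[OF M, of x x' "oc x"] by simp

lemma oc_sub: "x \<in> X \<Longrightarrow> v \<in> oc x \<Longrightarrow> v \<in> V \<and> v \<notin> X"
  using OC_sub oc(1) by blast

lemma oc_mate: "x \<in> X \<Longrightarrow> a \<in> oc x \<Longrightarrow> a \<noteq> M x \<Longrightarrow> M a \<in> oc x"
proof -
  assume x: "x \<in> X" and a: "a \<in> oc x" "a \<noteq> M x"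
  have aV: "a \<in> V" using oc_sub[OF x a(1)] by simp
  have "M a \<notin> X"
  proof
    assume "M a \<in> X"
    then have "M a = x" using OC_matched(2)[OF M, of "M a" x "oc x"] oc[OF x] x a(1) mateD(2)[OF M aV] by simp
    with mateD(2)[OF M aV] a(2) show False by simp
  qed
  then show "M a \<in> oc x" using OC_step[OF oc(1)[OF x] a(1) mateD(3)[OF M aV]] by blast
qed

lemma union_oc: "\<Union>OC = (\<Union>x\<in>X. oc x)"
  using oc(1) oc_surj by blast

lemma fc_mate: "mate E V n \<Longrightarrow> v \<in> V \<Longrightarrow> n v \<in> fc v"
  by (rule comp_of_step[OF comp_of_refl]) (auto simp: allowed_edges_iff[OF fin] dest: mateD(1))

lemma fc_sub: "v \<in> V \<Longrightarrow> fc v \<subseteq> V"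
  by (rule comp_of_sub)

lemma fc_eq: "u \<in> fc v \<Longrightarrow> fc u = fc v"
  by (rule comp_of_eq)

text \<open>This is the bipartite adjacency between \<open>X\<close> and the odd components, with
  each component identified with its label. The edges of \<open>M\<close> become loops, and paths of
  arcs correspond to \<open>M\<close>-alternating paths.\<close>

definition arc where "arc x x' \<longleftrightarrow> x \<in> X \<and> x' \<in> X \<and> (\<exists>w\<in>oc x'. {x, w} \<in> E)"

text \<open>Vertices on the path move to their successors and all others stay put. The clause about
  vertices off the path drives the induction: it makes the new start \<open>a\<close> a fixed point,
  which can be redirected to \<open>c\<close>, a value not yet taken. That \<open>b\<close> lies on
  the path shows \<open>a\<close> and \<open>b\<close> to be distinct in the step.\<close>

lemma arc_path_system:
  assumes "rtrancl_path arc a xs b" "distinct (a # xs)" "a \<in> X"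
  shows "b \<in> set (a # xs) \<and> b \<in> X \<and> (\<exists>p. inj_on p (X - {b}) \<and> p ` (X - {b}) \<subseteq> X - {a} \<and>
    (\<forall>z\<in>X - {b}. arc z (p z) \<and> (z \<notin> set (a # xs) \<longrightarrow> p z = z)))"
  using assms
proof (induction rule: rtrancl_path.induct)
  case (base a)
  have "arc z z" if "z \<in> X" for z
    using that oc(2)[OF that] mateD(3)[OF M, of z] XV by (auto simp: arc_def)
  then show ?case using base by (auto intro!: exI[of _ "\<lambda>z. z"])
next
  case (step a c xs b)
  have cX: "c \<in> X" using step.hyps(1) by (simp add: arc_def)
  with step obtain p where b: "b \<in> set (c # xs)" "b \<in> X"
    and p: "inj_on p (X - {b})" "p ` (X - {b}) \<subseteq> X - {c}"
      "\<And>z. z \<in> X - {b} \<Longrightarrow> arc z (p z) \<and> (z \<notin> set (c # xs) \<longrightarrow> p z = z)"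
    by auto
  have a: "a \<in> X - {b}" "p a = a" using step.prems b p(3)[of a] by auto
  have pa: "p z \<noteq> a" if "z \<in> X - {b}" "z \<noteq> a" for z
    using inj_onD[OF p(1), of z a] a that by auto
  have "inj_on (p(a := c)) (X - {b})"
    using p(2) by (intro inj_on_fun_updI[OF p(1)]) blast
  moreover have "(p(a := c)) ` (X - {b}) \<subseteq> X - {a}"
    using p(2) pa cX step.prems by auto
  moreover have "\<forall>z\<in>X - {b}. arc z ((p(a := c)) z) \<and> (z \<notin> set (a # c # xs) \<longrightarrow> (p(a := c)) z = z)"
    using p(3) step.hyps(1) by auto
  moreover have "b \<in> set (a # c # xs)" using b by simp
  ultimately show ?case using b(2) by blast
qed

text \<open>The partners of \<open>X\<close> all lie in odd components, and no edge joins an odd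
  component to the rest of \<open>G - X\<close>.\<close>

lemma even_part_mate:
  assumes "mate E V n" "v \<in> V - X - \<Union>OC"
  shows "n v \<in> V - X - \<Union>OC"
proof -
  have nn: "n (n v) = v" "n v \<in> V" "{n v, v} \<in> E"
    using mateD[OF assms(1), of v] assms(2) by (auto simp: insert_commute)
  have "n v \<notin> X" using OC_matched(1)[OF assms(1), of "n v"] nn(1) assms(2) by auto
  moreover have "n v \<notin> K" if "K \<in> OC" for K using OC_step[OF that _ nn(3)] assms(2) that by blast
  ultimately show ?thesis using nn(2) by blast
qed

text \<open>Shifting along a path from \<open>x'\<close> to \<open>x\<close> assigns
  \<open>X - {x}\<close> to all odd components except \<open>oc x'\<close>. Each of these is
  completed by factor-criticality, and so is \<open>oc x'\<close> without \<open>y\<close>; the even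
  part keeps \<open>M\<close>.\<close>

lemma matchable_reachable:
  assumes x: "x \<in> X" "x' \<in> X" and r: "arc\<^sup>*\<^sup>* x' x" and y: "y \<in> oc x'"
  shows "matchable E (V - {x, y})"
proof -
  obtain xs where "rtrancl_path arc x' xs x" "distinct (x' # xs)"
    using r rtrancl_path_distinct unfolding rtranclp_eq_rtrancl_path by metis
  from arc_path_system[OF this x(2)] obtain p where p: "inj_on p (X - {x})" "p ` (X - {x}) \<subseteq> X - {x'}"
    "\<And>z. z \<in> X - {x} \<Longrightarrow> arc z (p z)" by blast
  have "card (p ` (X - {x})) = card (X - {x'})"
    using x finX by (simp add: card_image[OF p(1)])
  \<comment> \<open>Equal cardinalities make \<open>p\<close> onto, so that \<open>oc x'\<close> is
    the only odd component left unassigned.\<close>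
  then have pim: "p ` (X - {x}) = X - {x'}" using p(2) finX by (intro card_subset_eq) auto
  have "\<forall>z\<in>X - {x}. \<exists>w. w \<in> oc (p z) \<and> {z, w} \<in> E" using p(3) unfolding arc_def by blast
  then obtain e where e: "\<And>z. z \<in> X - {x} \<Longrightarrow> e z \<in> oc (p z) \<and> {z, e z} \<in> E" by metis
  have pX: "p z \<in> X" if "z \<in> X - {x}" for z using p(2) that by blast
  define R where "R = (\<Union>z\<in>X - {x}. insert z (oc (p z)))"
  have "matchable E R"
    unfolding R_def
  proof (rule matchable_UN)
    fix z assume z: "z \<in> X - {x}"
    have "matchable E (insert z (insert (e z) (oc (p z) - {e z})))"
      using OC_factor_critical[OF oc(1)[OF pX[OF z]]] e[OF z] oc_sub[OF pX[OF z], of z] z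
      by (intro matchable_insert2) auto
    moreover have "insert z (insert (e z) (oc (p z) - {e z})) = insert z (oc (p z))"
      using e[OF z] by blast
    ultimately show "matchable E (insert z (oc (p z)))" by simp
  next
    show "disjoint_family_on (\<lambda>z. insert z (oc (p z))) (X - {x})"
      unfolding disjoint_family_on_def
    proof (intro ballI impI)
      fix z z' assume z: "z \<in> X - {x}" "z' \<in> X - {x}" "z \<noteq> z'"
      then have "p z \<noteq> p z'" using p(1) by (auto simp: inj_on_def)
      then have "oc (p z) \<inter> oc (p z') = {}" using oc_inj[OF pX[OF z(1)] pX[OF z(2)]] by blast
      then show "insert z (oc (p z)) \<inter> insert z' (oc (p z')) = {}"
        using z oc_sub[OF pX[OF z(1)]] oc_sub[OF pX[OF z(2)]] by blast
    qed
  qed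
  moreover have "matchable E (V - X - \<Union>OC)"
    by (rule matchableI[OF mate_subset[OF M _ even_part_mate[OF M]]]) auto
  moreover have "matchable E (oc x' - {y})" by (rule OC_factor_critical[OF oc(1)[OF x(2)] y])
  moreover have R: "R = (X - {x}) \<union> (\<Union>z\<in>X - {x'}. oc z)"
    unfolding R_def pim[symmetric] by blast
  moreover have "R \<inter> (oc x' - {y}) = {}"
    unfolding R using oc_inj[OF x(2)] oc_sub[OF x(2)] by blast
  moreover have "(R \<union> (oc x' - {y})) \<inter> (V - X - \<Union>OC) = {}"
    unfolding R union_oc using x(2) by blast
  ultimately have "matchable E (R \<union> (oc x' - {y}) \<union> (V - X - \<Union>OC))"
    using matchable_Un by metis
  moreover have "R \<union> (oc x' - {y}) \<union> (V - X - \<Union>OC) = V - {x, y}"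
    unfolding R union_oc using x y XV oc_sub oc_inj[OF x(2)] by blast
  ultimately show ?thesis by simp
qed

text \<open>The edge completes a perfect matching of the remaining vertices, which exists because
  the walk closes up with the arc from \<open>x\<close> to \<open>x'\<close>.\<close>

lemma arc_allowed:
  assumes "x \<in> X" "x' \<in> X" "w \<in> oc x'" "{x, w} \<in> E" "arc\<^sup>*\<^sup>* x' x"
  shows "{x, w} \<in> Al"
proof -
  obtain n where n: "mate E (V - {x, w}) n"
    using matchable_reachable[OF assms(1,2,5,3)] by (auto simp: matchable_def)
  have xw: "x \<in> V" "w \<in> V" "x \<noteq> w" using fin_graph_edge[OF fin assms(4)] simple_neq[OF simp_E assms(4)] by auto
  have "insert x (insert w (V - {x, w})) = V" using xw by blast
  with mate_insert2[OF n assms(4)] xw have "mate E V (n(x := w, w := x))" by simp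
  then show ?thesis unfolding allowed_edges_iff[OF fin]
    using xw by (intro exI[of _ "n(x := w, w := x)"]) simp
qed

text \<open>The perfect matchings \<open>n\<close> and \<open>M\<close> together induce a permutation of the finite set \<open>X\<close>, so
  every \<open>n\<close>-step can be undone by iterating.\<close>

lemma mate_reach_back:
  assumes n: "mate E V n" and x: "x \<in> X" "x' \<in> X" "n x \<in> oc x'"
  shows "arc x x'" "arc\<^sup>*\<^sup>* x' x"
proof -
  have "\<exists>z'. z' \<in> X \<and> n z \<in> oc z'" if "z \<in> X" for z
    using OC_matched(1)[OF n that] oc_surj by blast
  then obtain s where s: "\<And>z. z \<in> X \<Longrightarrow> s z \<in> X \<and> n z \<in> oc (s z)" by metis
  have edge: "{z, n z} \<in> E" if "z \<in> X" for z using mateD(3)[OF n] that XV by blast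
  have arc_s: "arc z (s z)" if "z \<in> X" for z using s[OF that] edge[OF that] that by (auto simp: arc_def)
  have sx: "s x = x'" using oc_inj[of "s x" x' "n x"] s[OF x(1)] x by blast
  show "arc x x'" using arc_s[OF x(1)] sx by simp
  \<comment> \<open>\<open>s\<close> maps \<open>T\<close> into itself and is injective, hence
    permutes \<open>T\<close>. As \<open>x'\<close> lies in \<open>T\<close>, so does its only
    preimage \<open>x\<close>.\<close>
  define T where "T = {z \<in> X. arc\<^sup>*\<^sup>* x' z}"
  have "s ` T \<subseteq> T"
    using s arc_s by (auto simp: T_def intro: rtranclp.rtrancl_into_rtrancl)
  moreover have inj: "inj_on s X"
  proof
    fix a b assume ab: "a \<in> X" "b \<in> X" "s a = s b"
    then show "a = b" using OC_matched(2)[OF n ab(1,2) oc(1)[of "s a"]] s[OF ab(1)] s[OF ab(2)] by simp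
  qed
  moreover have "T \<subseteq> X" by (auto simp: T_def)
  ultimately have "s ` T = T" using finX
    by (intro endo_inj_surj) (auto intro: finite_subset inj_on_subset)
  moreover have "x' \<in> T" using x by (simp add: T_def)
  ultimately obtain z where "z \<in> T" "s z = x'" by (metis imageE)
  then have "x \<in> T" using inj_onD[OF inj, of z x] sx x(1) \<open>T \<subseteq> X\<close> by auto
  then show "arc\<^sup>*\<^sup>* x' x" by (simp add: T_def)
qed

section \<open>Position of the factor-components relative to the odd components\<close>

lemma fc_linked:
  assumes x: "x \<in> X" and y: "y \<in> fc x"
  shows "\<exists>x'\<in>X. (y = x' \<or> y \<in> oc x') \<and> arc\<^sup>*\<^sup>* x x' \<and> arc\<^sup>*\<^sup>* x' x"
proof -
  define L where "L = {x' \<in> X. arc\<^sup>*\<^sup>* x x' \<and> arc\<^sup>*\<^sup>* x' x}"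
  have LX: "z \<in> X" if "z \<in> L" for z using that by (simp add: L_def)
  have L_step: "z' \<in> L" if "z \<in> L" "arc\<^sup>*\<^sup>* z z'" "arc\<^sup>*\<^sup>* z' z" "z' \<in> X" for z z'
    using that unfolding L_def by (auto intro: rtranclp_trans)
  \<comment> \<open>An allowed edge lies in some perfect matching. Within an odd component it keeps
    the label, and between \<open>X\<close> and an odd component it joins mutually reachable labels
    by \<open>mate_reach_back\<close>.\<close>
  have "closed_in Al V {y \<in> V. \<exists>x'\<in>L. y = x' \<or> y \<in> oc x'}"
    unfolding closed_in_def
  proof (intro conjI ballI impI)
    fix a b assume "a \<in> {y \<in> V. \<exists>x'\<in>L. y = x' \<or> y \<in> oc x'}" and b: "b \<in> V" "{a, b} \<in> Al"
    then obtain z where a: "a \<in> V" and z: "z \<in> L" "a = z \<or> a \<in> oc z" by blast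
    obtain n where n: "mate E V n" "n a = b" using b(2) by (auto simp: allowed_edges_iff[OF fin])
    have "\<exists>x'\<in>L. b = x' \<or> b \<in> oc x'"
    proof (cases "a = z")
      case True
      have zX: "a \<in> X" using LX z True by simp
      obtain z' where z': "z' \<in> X" "n a \<in> oc z'" using OC_matched(1)[OF n(1) zX] oc_surj by blast
      note mr = mate_reach_back[OF n(1) zX z']
      have "z' \<in> L" using L_step[OF z(1) _ _ z'(1)] mr True by auto
      with z' n(2) show ?thesis by blast
    next
      case False
      then have az: "a \<in> oc z" using z by blast
      show ?thesis
      proof (cases "b \<in> oc z")
        case True
        then show ?thesis using z by blast
      next
        case False
        have "{a, b} \<in> E" using b(2) allowed_edges_subset by blast
        then have bX: "b \<in> X" using OC_step[OF oc(1)[OF LX[OF z(1)]] az] False by blast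
        have "n b = a" using mateD(2)[OF n(1) a] n(2) by simp
        with mate_reach_back[OF n(1) bX LX[OF z(1)]] az have "arc b z" "arc\<^sup>*\<^sup>* z b" by auto
        then have "b \<in> L" using L_step[OF z(1) _ _ bX] by blast
        then show ?thesis by blast
      qed
    qed
    then show "b \<in> {y \<in> V. \<exists>x'\<in>L. y = x' \<or> y \<in> oc x'}" using b(1) by blast
  qed auto
  from comp_of_subset[OF this, of x] have "fc x \<subseteq> {y \<in> V. \<exists>x'\<in>L. y = x' \<or> y \<in> oc x'}"
    using x XV by (auto simp: L_def)
  with y show ?thesis unfolding L_def by blast
qed

text \<open>The factor-components through which two perfect matchings leave an odd component agree, because
  a perfect matching leaves \<open>oc x\<close> through the unique factor-component meeting it in an odd set.\<close>

lemma exit_factor_component: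
  assumes n: "mate E V n" and x: "x \<in> X" and k: "k \<in> oc x" "n k \<in> X"
  shows "fc (n k) = fc x"
proof (rule ccontr)
  assume ne: "fc (n k) \<noteq> fc x"
  define W where "W = fc x \<inter> oc x"
  have xV: "x \<in> V" using x XV by blast
  have finW: "finite W" using fin_OC[OF oc(1)[OF x]] by (simp add: W_def)
  have WV: "a \<in> V" if "a \<in> W" for a using that oc_sub[OF x] by (auto simp: W_def)
  have MW: "M x \<in> W" using oc(2)[OF x] fc_mate[OF M xV] by (simp add: W_def)
  \<comment> \<open>\<open>M\<close> leaves \<open>oc x\<close> only at \<open>M x\<close>, so it
    pairs the other vertices of \<open>W\<close> and \<open>W\<close> is odd.\<close>
  have "mate E (W - {M x}) M"
  proof (rule mate_subset[OF M])
    show "W - {M x} \<subseteq> V" using WV by blast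
    fix b assume b: "b \<in> W - {M x}"
    then have "b \<in> V" "fc b = fc x" using WV fc_eq by (auto simp: W_def)
    then have "M b \<in> fc x" using fc_mate[OF M, of b] by simp
    moreover have "M b \<in> oc x" using oc_mate[OF x] b by (auto simp: W_def)
    moreover have "M b \<noteq> M x" using mate_inj[OF M \<open>b \<in> V\<close> xV] b oc_sub[OF x] x by (auto simp: W_def)
    ultimately show "M b \<in> W - {M x}" by (simp add: W_def)
  qed
  then have "even (card (W - {M x}))" using mate_even[OF simp_E] finW by blast
  then have "odd (card W)" using card_Suc_Diff1[OF finW MW] by presburger
  \<comment> \<open>The only vertex of \<open>X\<close> that \<open>n\<close> matches into
    \<open>oc x\<close> is \<open>n k\<close>, which lies in another factor-component; so
    \<open>n\<close> would pair up all of \<open>W\<close>.\<close>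
  moreover have "mate E W n"
  proof (rule mate_subset[OF n])
    show "W \<subseteq> V" using WV by blast
    fix b assume b: "b \<in> W"
    then have bV: "b \<in> V" and bf: "fc b = fc x" and bo: "b \<in> oc x" using WV fc_eq by (auto simp: W_def)
    have nb: "n b \<in> fc x" using fc_mate[OF n bV] bf by simp
    have "n b \<notin> X"
    proof
      assume nX: "n b \<in> X"
      have "n (n b) \<in> oc x" "n (n k) \<in> oc x"
        using mateD(2)[OF n bV] mateD(2)[OF n, of k] oc_sub[OF x k(1)] bo k(1) by simp_all
      then have "n b = n k" by (rule OC_matched(2)[OF n nX k(2) oc(1)[OF x]])
      then show False using fc_eq[OF nb] ne by simp
    qed
    then have "n b \<in> oc x" using OC_step[OF oc(1)[OF x] bo mateD(3)[OF n bV]] by blast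
    with nb show "n b \<in> W" by (simp add: W_def)
  qed
  then have "even (card W)" using mate_even[OF simp_E finW] by blast
  ultimately show False by simp
qed

text \<open>An allowed edge can leave \<open>oc x\<close> only towards \<open>X\<close>, and by
  \<open>exit_factor_component\<close> it then belongs to the factor-component of
  \<open>x\<close>.\<close>

lemma fc_within_oc:
  assumes x: "x \<in> X" and v: "v \<in> oc x" "fc v \<noteq> fc x"
  shows "fc v \<subseteq> oc x"
proof -
  have "closed_in Al V (fc v \<inter> oc x)"
    unfolding closed_in_def
  proof (intro conjI ballI impI)
    show "fc v \<inter> oc x \<subseteq> V" using oc_sub[OF x] by blast
    fix a b assume a: "a \<in> fc v \<inter> oc x" and b: "b \<in> V" "{a, b} \<in> Al"
    obtain n where n: "mate E V n" "n a = b" using b(2) by (auto simp: allowed_edges_iff[OF fin])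
    have aV: "a \<in> V" using a oc_sub[OF x] by blast
    have bv: "b \<in> fc v" using fc_mate[OF n(1) aV] n(2) a fc_eq[of a v] by auto
    have "b \<notin> X"
    proof
      assume "b \<in> X"
      then have "fc b = fc x" using exit_factor_component[OF n(1) x, of a] a n(2) by auto
      with fc_eq[OF bv] v(2) show False by simp
    qed
    then have "b \<in> oc x"
      using OC_step[OF oc(1)[OF x], of a b] a mateD(3)[OF n(1) aV] n(2) by blast
    with bv show "b \<in> fc v \<inter> oc x" by blast
  qed
  from comp_of_subset[OF this, of v] v(1) show ?thesis by simp
qed

text \<open>The label \<open>z\<close> of the odd component of \<open>y\<close> must share the
  factor-component of \<open>y\<close>; otherwise \<open>fc_within_oc\<close> would put
  \<open>x\<close> inside \<open>oc z\<close>, which is disjoint from \<open>X\<close>.\<close>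

lemma fc_outside_X:
  assumes x: "x \<in> X" and y: "y \<in> fc x" "y \<notin> X"
  shows "\<exists>z\<in>X \<inter> fc x. y \<in> oc z"
proof -
  obtain z where z: "z \<in> X" "y \<in> oc z" using fc_linked[OF x y(1)] y(2) by blast
  have yx: "fc y = fc x" by (rule fc_eq[OF y(1)])
  have "fc y = fc z"
  proof (rule ccontr)
    assume "fc y \<noteq> fc z"
    from fc_within_oc[OF z this] yx have "fc x \<subseteq> oc z" by simp
    then have "x \<in> oc z" using comp_of_refl[of x Al V] by (rule subsetD)
    with oc_sub[OF z(1)] x show False by blast
  qed
  then have "z \<in> fc x" using yx comp_of_refl[of z Al V] by simp
  with z show ?thesis by blast
qed

section \<open>The cathedral order above a factor-component meeting the barrier\<close>

text \<open>Removing \<open>X - B\<close> from \<open>V - B\<close> still leaves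
  \<open>card X\<close> odd components, which is too many unless \<open>B\<close> is empty.\<close>

lemma matchable_delete_subset:
  assumes "B \<subseteq> X" "matchable E (V - B)"
  shows "B = {}"
proof -
  have "V - B - (X - B) = V - X" "X - B \<subseteq> V - B" using assms(1) XV by blast+
  then have "card X \<le> card (X - B)"
    using card_odd_comps_le[OF simp_E _ assms(2), of "X - B"] finV card_OC by simp
  then have "X - B = X" using card_subset_eq[OF finX, of "X - B"] card_mono[OF finX, of "X - B"] by auto
  with assms(1) show ?thesis by blast
qed

abbreviation "fcg v \<equiv> induced G (fc v)"

lemma verts_fcg: "v \<in> V \<Longrightarrow> verts (fcg v) = fc v"
  using fc_sub by (auto simp: Int_absorb1)

lemma fcg_eq_iff: "v \<in> V \<Longrightarrow> w \<in> V \<Longrightarrow> fcg v = fcg w \<longleftrightarrow> fc v = fc w"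
  using verts_fcg by metis

lemma factor_components_fcg: "factor_components G = fcg ` V"
  by (simp add: factor_components_eq[OF fin fact] comps_def image_image)

lemma separating_iff: "separating G Z \<longleftrightarrow> Z \<subseteq> V \<and> (\<forall>v\<in>Z. fc v \<subseteq> Z)"
proof
  assume s: "separating G Z"
  have "fc v \<subseteq> Z" if v: "v \<in> Z" for v
  proof -
    have vV: "v \<in> V" using s v by (auto simp: separating_def)
    then have "fcg v \<in> factor_components G" by (simp add: factor_components_fcg)
    then have "fc v \<subseteq> Z \<or> fc v \<inter> Z = {}" using s verts_fcg[OF vV] unfolding separating_def by metis
    moreover have "v \<in> fc v" by simp
    ultimately show ?thesis using v by blast
  qed
  then show "Z \<subseteq> V \<and> (\<forall>v\<in>Z. fc v \<subseteq> Z)" using s by (auto simp: separating_def)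
next
  assume Z: "Z \<subseteq> V \<and> (\<forall>v\<in>Z. fc v \<subseteq> Z)"
  have "verts H \<subseteq> Z \<or> verts H \<inter> Z = {}" if "H \<in> factor_components G" for H
  proof -
    obtain v where v: "v \<in> V" "H = fcg v" using \<open>H \<in> factor_components G\<close> by (auto simp: factor_components_fcg)
    then have H: "verts H = fc v" using verts_fcg by simp
    show ?thesis
    proof (cases "fc v \<inter> Z = {}")
      case False
      then obtain u where "u \<in> fc v" "u \<in> Z" by blast
      then have "fc v \<subseteq> Z" using Z fc_eq[of u v] by blast
      then show ?thesis using H by simp
    qed (use H in simp)
  qed
  with Z show "separating G Z" by (simp add: separating_def)
qed

lemma cathedral_le_fcg:
  assumes "v \<in> V" "w \<in> V"
  shows "cathedral_le G (fcg v) (fcg w) \<longleftrightarrow> (\<exists>Z. Z \<subseteq> V \<and> (\<forall>u\<in>Z. fc u \<subseteq> Z) \<and> fc v \<subseteq> Z \<and> fc w \<subseteq> Z \<and>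
    factor_critical (contract (induced G Z) (fc v)))"
  using assms by (simp add: cathedral_le_def factor_components_fcg separating_iff verts_fcg del: verts_induced)

lemma upper_star_fcg:
  assumes "v \<in> V"
  shows "upper_star G (fcg v) = {w \<in> V. cathedral_le G (fcg v) (fcg w)}" (is "?L = ?R")
proof
  show "?R \<subseteq> ?L"
  proof
    fix w assume w: "w \<in> ?R"
    then have "w \<in> verts (fcg w)" using verts_fcg[of w] by simp
    moreover have "fcg w \<in> upper_comps_star G (fcg v)"
      using w by (simp add: upper_comps_star_def factor_components_fcg)
    ultimately show "w \<in> ?L" unfolding upper_star_def by blast
  qed
  show "?L \<subseteq> ?R"
  proof
    fix w assume "w \<in> ?L"
    then obtain H where H: "H \<in> factor_components G" "cathedral_le G (fcg v) H" "w \<in> verts H"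
      by (auto simp: upper_star_def upper_comps_star_def)
    then obtain u where u: "u \<in> V" "H = fcg u" by (auto simp: factor_components_fcg)
    then have wu: "w \<in> fc u" using H(3) verts_fcg by simp
    then have "w \<in> V" "fc w = fc u" using fc_sub[OF u(1)] fc_eq by auto
    then show "w \<in> ?R" using H(2) u(2) by simp
  qed
qed

lemma canonical_class:
  assumes x: "x \<in> X"
  shows "gen_canonical_rel G `` {x} = X \<inter> fc x"
proof -
  have xV: "x \<in> V" using x XV by blast
  have rel: "(x, y) \<in> gen_canonical_rel G \<longleftrightarrow> y \<in> fc x \<and> \<not> matchable E (V - {x, y})" for y
  proof -
    have "(\<exists>H\<in>factor_components G. x \<in> verts H \<and> y \<in> verts H) \<longleftrightarrow> y \<in> fc x"
    proof
      assume "\<exists>H\<in>factor_components G. x \<in> verts H \<and> y \<in> verts H"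
      then obtain u where u: "u \<in> V" "x \<in> verts (fcg u)" "y \<in> verts (fcg u)"
        by (auto simp only: factor_components_fcg)
      then have "x \<in> fc u" "y \<in> fc u" using verts_fcg[OF u(1)] by auto
      then show "y \<in> fc x" using fc_eq by blast
    next
      assume "y \<in> fc x"
      then show "\<exists>H\<in>factor_components G. x \<in> verts H \<and> y \<in> verts H"
        unfolding factor_components_fcg using xV verts_fcg[OF xV] comp_of_refl[of x Al V] by blast
    qed
    then show ?thesis by (simp add: gen_canonical_rel_def factorizable_delete[OF fin])
  qed
  have "\<not> matchable E (V - {x, y}) \<longleftrightarrow> y \<in> X" if y: "y \<in> fc x" for y
  proof (cases "y \<in> X")
    case True
    \<comment> \<open>The deleted set may be a singleton, so the case \<open>y = x\<close> is
      included.\<close>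
    then show ?thesis using matchable_delete_subset[of "{x, y}"] x by blast
  next
    case False
    obtain x' where "x' \<in> X" "y \<in> oc x'" "arc\<^sup>*\<^sup>* x' x" using fc_linked[OF x y] False by blast
    then show ?thesis using matchable_reachable[OF x] False by blast
  qed
  then show ?thesis using rel by blast
qed

lemma matchable_fc_closed:
  assumes "A \<subseteq> V" "\<And>a. a \<in> A \<Longrightarrow> fc a \<subseteq> A"
  shows "mate E A M"
  by (rule mate_subset[OF M assms(1)]) (use assms fc_mate[OF M] in blast)

text \<open>The separating set is \<open>fc x\<close> together with \<open>oc z\<close>. After
  contraction it is factor-critical because \<open>oc z\<close> is: a matching of
  \<open>oc z\<close> without \<open>u\<close> is combined with \<open>M\<close> along an
  alternating path that ends at an edge into \<open>fc x\<close>.\<close>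

lemma oc_upper:
  assumes x: "x \<in> X" and z: "z \<in> X \<inter> fc x" and v: "v \<in> oc z"
  shows "cathedral_le G (fcg x) (fcg v)"
proof -
  have zX: "z \<in> X" and fz: "fc z = fc x" using z fc_eq by auto
  have xV: "x \<in> V" and vV: "v \<in> V" using x XV oc_sub[OF zX v] by auto
  define Z where "Z = fc x \<union> oc z"
  have ZV: "Z \<subseteq> V" using fc_sub[OF xV] oc_sub[OF zX] by (auto simp: Z_def)
  have ZW: "fc x \<subseteq> Z" by (simp add: Z_def)
  have W: "fc x \<noteq> {}" using comp_of_refl[of x] by blast
  have cl_Z: "fc u \<subseteq> Z" if u: "u \<in> Z" for u
  proof (cases "fc u = fc x")
    case False
    then have "u \<in> oc z" using u fc_eq by (auto simp: Z_def)
    then show ?thesis using fc_within_oc[OF zX, of u] False fz by (auto simp: Z_def)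
  qed (simp add: Z_def)
  define A where "A = Z - fc x"
  have cl_A: "fc u \<subseteq> A" if u: "u \<in> A" for u
  proof
    fix b assume b: "b \<in> fc u"
    have "b \<notin> fc x"
    proof
      assume "b \<in> fc x"
      then have "fc u = fc x" using fc_eq[OF b] fc_eq[of b x] by simp
      then show False using u comp_of_refl[of u Al V] by (simp add: A_def)
    qed
    then show "b \<in> A" using cl_Z[of u] b u by (auto simp: A_def)
  qed
  have mA: "mate E A M" using matchable_fc_closed[of A] ZV cl_A by (auto simp: A_def)
  have Aoc: "A \<subseteq> oc z" by (auto simp: A_def Z_def)
  have finA: "finite A" using finite_subset[OF Aoc] fin_OC[OF oc(1)[OF zX]] by simp
  have crit: "factor_critical (contract (induced G Z) (fc x))"
  proof (rule factor_critical_contractI[OF fin ZW ZV W])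
    show "matchable E (Z - fc x)" using matchableI[OF mA] by (simp add: A_def)
    fix u assume "u \<in> Z - fc x"
    then have u: "u \<in> A" by (simp add: A_def)
    obtain l where l: "mate E (oc z - {u}) l"
      using OC_factor_critical[OF oc(1)[OF zX]] u Aoc by (auto simp: matchable_def)
    have sub: "A - {u} \<subseteq> oc z - {u}" using Aoc by blast
    \<comment> \<open>The alternating path from \<open>u\<close> uses \<open>M\<close> on
      \<open>A\<close> and \<open>l\<close> on \<open>oc z - {u}\<close>. Where \<open>l\<close>
      leaves \<open>A\<close> it stays in \<open>oc z\<close>, hence enters
      \<open>fc x\<close>.\<close>
    obtain w where w: "w \<in> A - {u}" "l w \<notin> A" "matchable E (A - {u, w})"
      using alternating_exit[OF simp_E finA mA u l sub] by blast
    have wo: "w \<in> oc z - {u}" using w(1) Aoc by blast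
    have "l w \<in> fc x" using mateD(1)[OF l wo] w(2) by (auto simp: A_def Z_def)
    then show "\<exists>w\<in>Z - fc x - {u}. \<exists>h\<in>fc x. {w, h} \<in> E \<and> matchable E (Z - fc x - {u, w})"
      using w(1,3) mateD(3)[OF l wo] unfolding A_def by blast
  qed
  have vZ: "fc v \<subseteq> Z" using cl_Z[of v] v by (simp add: Z_def)
  show ?thesis
    unfolding cathedral_le_fcg[OF xV vV] by (intro exI[of _ Z] conjI ballI ZV cl_Z ZW vZ crit)
qed

text \<open>Deleting \<open>z'\<close> from the factor-critical contraction leaves too few vertices of \<open>X\<close> to match
  the odd components from which \<open>z'\<close> is reachable, unless one of them is matched into \<open>fc x\<close>.\<close>

lemma upper_not_adjacent:
  assumes x: "x \<in> X" and z: "z \<in> X \<inter> fc x" and w: "w \<in> oc z" and z': "z' \<in> X"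
    and le: "cathedral_le G (fcg x) (fcg z')" and edge: "{z', w} \<in> E"
  shows "fc z' = fc x"
proof (rule ccontr)
  assume ne: "fc z' \<noteq> fc x"
  have xV: "x \<in> V" "z' \<in> V" using x z' XV by auto
  have zX: "z \<in> X" and fz: "fc z = fc x" using z fc_eq by auto
  from le obtain Z where Z0: "Z \<subseteq> V \<and> (\<forall>u\<in>Z. fc u \<subseteq> Z) \<and> fc x \<subseteq> Z \<and> fc z' \<subseteq> Z \<and>
    factor_critical (contract (induced G Z) (fc x))"
    unfolding cathedral_le_fcg[OF xV] by (rule exE)
  then have Z: "Z \<subseteq> V" "fc x \<subseteq> Z" "fc z' \<subseteq> Z"
    "factor_critical (contract (induced G Z) (fc x))"
    by blast+
  have cl_Z: "fc u \<subseteq> Z" if "u \<in> Z" for u using Z0 that by (elim conjE) (rule bspec)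
  have W: "fc x \<noteq> {}" using comp_of_refl[of x] by blast
  define A where "A = Z - fc x"
  have notW: "u \<notin> fc x" if "fc u \<noteq> fc x" for u using fc_eq[of u x] that by blast
  have z'A: "z' \<in> A" using Z(3) comp_of_refl[of z' Al V] notW[OF ne] by (auto simp: A_def)
  have cl_A: "fc u \<subseteq> A" if u: "u \<in> A" for u
  proof
    fix b assume b: "b \<in> fc u"
    have "fc u \<noteq> fc x" using u comp_of_refl[of u Al V] by (auto simp: A_def)
    then have "b \<notin> fc x" using notW[of b] fc_eq[OF b] by simp
    then show "b \<in> A" using cl_Z[of u] u b by (auto simp: A_def)
  qed
  have AV: "A \<subseteq> V" using Z(1) by (auto simp: A_def)
  have mA: "mate E A M" by (rule matchable_fc_closed[OF AV cl_A])
  \<comment> \<open>\<open>w0\<close> is the partner of the contracted vertex once \<open>z'\<close>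
    is deleted.\<close>
  obtain w0 h where w0: "w0 \<in> A" "w0 \<noteq> z'" "h \<in> fc x" "{w0, h} \<in> E" "matchable E (A - {z', w0})"
    using factor_critical_contractD[OF fin Z(2,1) W Z(4), of z'] z'A unfolding A_def by blast
  obtain l where l: "mate E (A - {z', w0}) l" using w0(5) by (auto simp: matchable_def)
  have "\<exists>s\<in>X \<inter> fc x. arc\<^sup>*\<^sup>* s z'"
  proof (rule ccontr)
    assume none: "\<not> ?thesis"
    \<comment> \<open>All components \<open>oc t\<close> with \<open>t\<close> in \<open>T\<close>
      must be served by \<open>T - {z'}\<close>, because an arc into such a component starts at a
      vertex that again reaches \<open>z'\<close>.\<close>
    define T where "T = {t \<in> X \<inter> A. arc\<^sup>*\<^sup>* t z'}"
    have TX: "t \<in> X" "t \<in> A" "arc\<^sup>*\<^sup>* t z'" if "t \<in> T" for t using that by (auto simp: T_def)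
    have T_arc: "s \<in> T" if "t \<in> T" "s \<in> A" "s \<in> X" "a \<in> oc t" "{s, a} \<in> E" for s t a
    proof -
      have "arc s t" using that TX(1)[OF that(1)] by (auto simp: arc_def)
      then show ?thesis using TX(3)[OF that(1)] that(2,3) by (simp add: T_def converse_rtranclp_into_rtranclp)
    qed
    \<comment> \<open>The neighbour \<open>h\<close> of \<open>w0\<close> would lie in
      \<open>oc t\<close> or in \<open>X\<close>. The former traps \<open>fc x\<close>, and with it
      \<open>x\<close>, inside \<open>oc t\<close>; the latter makes \<open>h\<close> the vertex
      just denied to exist.\<close>
    have w0T: "w0 \<notin> oc t" if t: "t \<in> T" for t
    proof
      assume w0t: "w0 \<in> oc t"
      have "h \<in> oc t \<or> h \<in> X" using OC_step[OF oc(1)[OF TX(1)[OF t]] w0t w0(4)] .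
      then show False
      proof
        assume h: "h \<in> oc t"
        have fh: "fc h = fc x" using fc_eq[OF w0(3)] .
        have "fc h \<noteq> fc t" using fh TX(2)[OF t] comp_of_refl[of t Al V] by (auto simp: A_def)
        from fc_within_oc[OF TX(1)[OF t] h this] fh have "fc x \<subseteq> oc t" by simp
        then have "x \<in> oc t" using comp_of_refl[of x Al V] by (rule subsetD)
        with oc_sub[OF TX(1)[OF t]] x show False by blast
      next
        assume h: "h \<in> X"
        have "{h, w0} \<in> E" using w0(4) by (simp add: insert_commute)
        then have "arc h t" using h w0t TX(1)[OF t] by (auto simp: arc_def)
        then have "arc\<^sup>*\<^sup>* h z'" using TX(3)[OF t] by (rule converse_rtranclp_into_rtranclp)
        with none h w0(3) show False by blast
      qed
    qed
    \<comment> \<open>\<open>M\<close> pairs \<open>oc t \<inter> A\<close> except for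
      \<open>M t\<close>, so this set is odd and \<open>l\<close> has to leave it. Staying in
      \<open>A\<close>, \<open>l\<close> can only go to a vertex of \<open>X\<close> that reaches
      \<open>z'\<close>.\<close>
    have "\<exists>a. a \<in> oc t \<inter> A \<and> l a \<in> T - {z'}" if t: "t \<in> T" for t
    proof (rule ccontr)
      assume n: "\<not> ?thesis"
      define B where "B = oc t \<inter> A"
      have tV: "t \<in> V" using TX(1)[OF t] XV by blast
      have finB: "finite B" using fin_OC[OF oc(1)[OF TX(1)[OF t]]] by (simp add: B_def)
      have MB: "M t \<in> B" using oc(2)[OF TX(1)[OF t]] mateD(1)[OF mA TX(2)[OF t]] by (simp add: B_def)
      have "mate E (B - {M t}) M"
      proof (rule mate_subset[OF mA])
        fix b assume b: "b \<in> B - {M t}"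
        then have bA: "b \<in> A" "b \<in> oc t" by (auto simp: B_def)
        have "M b \<in> B" using oc_mate[OF TX(1)[OF t] bA(2)] b mateD(1)[OF mA bA(1)] by (auto simp: B_def)
        moreover have "M b \<noteq> M t"
          using mate_inj[OF mA bA(1) TX(2)[OF t]] oc_sub[OF TX(1)[OF t] bA(2)] TX(1)[OF t] by blast
        ultimately show "M b \<in> B - {M t}" by blast
      qed (auto simp: B_def)
      then have "even (card (B - {M t}))" using mate_even[OF simp_E] finB by blast
      then have "odd (card B)" using card_Suc_Diff1[OF finB MB] by presburger
      moreover have "mate E B l"
      proof (rule mate_subset[OF l])
        show BA: "B \<subseteq> A - {z', w0}"
          using w0T[OF t] oc_sub[OF TX(1)[OF t]] z' by (auto simp: B_def)
        fix b assume b: "b \<in> B"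
        then have bo: "b \<in> oc t" "b \<in> oc t \<inter> A" by (auto simp: B_def)
        have bA: "b \<in> A - {z', w0}" using b BA by blast
        note lb = mateD[OF l bA]
        have "l b \<notin> X"
        proof
          assume "l b \<in> X"
          then have "l b \<in> T" using T_arc[OF t _ _ bo(1), of "l b"] lb by (simp add: insert_commute)
          then show False using n bo(2) lb(1) by blast
        qed
        then have "l b \<in> oc t" using OC_step[OF oc(1)[OF TX(1)[OF t]] bo(1) lb(3)] by blast
        then show "l b \<in> B" using lb(1) by (simp add: B_def)
      qed
      then have "even (card B)" using mate_even[OF simp_E finB] by blast
      ultimately show False by simp
    qed
    then obtain f where f: "\<And>t. t \<in> T \<Longrightarrow> f t \<in> oc t \<inter> A \<and> l (f t) \<in> T - {z'}" by metis
    have fA: "f t \<in> A - {z', w0}" if t: "t \<in> T" for t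
    proof -
      have ft: "f t \<in> oc t" "f t \<in> A" using f[OF t] by auto
      moreover have "f t \<noteq> w0" using w0T[OF t] ft(1) by blast
      moreover have "f t \<noteq> z'" using oc_sub[OF TX(1)[OF t] ft(1)] z' by blast
      ultimately show ?thesis by blast
    qed
    have "inj_on (\<lambda>t. l (f t)) T"
    proof
      fix t t' assume t: "t \<in> T" "t' \<in> T" "l (f t) = l (f t')"
      then have "f t = f t'" using mate_inj[OF l fA[OF t(1)] fA[OF t(2)]] by blast
      then show "t = t'" using oc_inj[OF TX(1)[OF t(1)] TX(1)[OF t(2)], of "f t"] f[OF t(1)] f[OF t(2)] by simp
    qed
    moreover have finT: "finite T" using finX by (simp add: T_def)
    ultimately have "card T \<le> card (T - {z'})" using f by (intro card_inj_on_le) auto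
    moreover have "z' \<in> T" using z' z'A by (simp add: T_def)
    then have "card (T - {z'}) < card T" by (rule card_Diff1_less[OF finT])
    ultimately show False by simp
  qed
  then obtain s where s: "s \<in> X" "s \<in> fc x" "arc\<^sup>*\<^sup>* s z'" by blast
  \<comment> \<open>\<open>z\<close> reaches \<open>s\<close> within their common factor-component,
    and \<open>s\<close> reaches \<open>z'\<close>. With the edge from \<open>z'\<close> into
    \<open>oc z\<close> the walk closes.\<close>
  have "s \<in> fc z" using s(2) fz by simp
  then obtain s' where s': "s' \<in> X" "s = s' \<or> s \<in> oc s'" "arc\<^sup>*\<^sup>* z s'" using fc_linked[OF zX] by blast
  have "s = s'" using s' oc_sub[OF s'(1)] s(1) by blast
  with s'(3) s(3) have "arc\<^sup>*\<^sup>* z z'" by simp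
  from arc_allowed[OF z' zX w edge this] have "{z', w} \<in> Al" .
  then obtain n where n: "mate E V n" "n z' = w" by (auto simp: allowed_edges_iff[OF fin])
  then have "n w = z'" using mateD(2)[OF n(1) xV(2)] by simp
  then have "fc z' = fc z" using exit_factor_component[OF n(1) zX w] z' by simp
  with fz ne show False by simp
qed

text \<open>For one inclusion, a component of \<open>G[U(H)]\<close> that witnesses membership in
  \<open>U(S)\<close> and meets \<open>oc z\<close> would swallow all of \<open>oc z\<close>,
  including \<open>M z\<close>, which lies in \<open>H\<close>. For the other, a component that
  touches \<open>H\<close> outside \<open>X\<close> enters some \<open>oc z\<close> and cannot leave
  it.\<close>

lemma upper_star_diff:
  assumes x: "x \<in> X"
  shows "upper_star G (fcg x) - class_upper_star G (fcg x) (X \<inter> fc x) = (\<Union>z\<in>X \<inter> fc x. oc z)"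
proof -
  define U where "U = upper G (fcg x)"
  have xV: "x \<in> V" using x XV by blast
  have US: "upper_star G (fcg x) = {w \<in> V. cathedral_le G (fcg x) (fcg w)}" by (rule upper_star_fcg[OF xV])
  have U: "U = {w \<in> V. cathedral_le G (fcg x) (fcg w)} - fc x"
    by (simp only: U_def upper_def US verts_fcg[OF xV])
  have UV: "U \<subseteq> V" by (auto simp: U)
  have U_fc: "fc w \<subseteq> U" if w: "w \<in> U" for w
  proof
    fix b assume b: "b \<in> fc w"
    have wV: "w \<in> V" "cathedral_le G (fcg x) (fcg w)" "w \<notin> fc x" using w by (auto simp: U)
    have "b \<in> V" "fc b = fc w" using fc_sub[OF wV(1)] fc_eq[OF b] b by auto
    moreover have "b \<notin> fc x"
    proof
      assume "b \<in> fc x"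
      then have "fc w = fc x" using fc_eq[of b x] \<open>fc b = fc w\<close> by simp
      then show False using wV(3) comp_of_refl[of w Al V] by simp
    qed
    ultimately show "b \<in> U" using wV(2) by (simp add: U)
  qed
  have mem: "w \<in> class_upper G (fcg x) (X \<inter> fc x) \<longleftrightarrow>
      w \<in> U \<and> (\<exists>K\<in>comps E U. nbrs G K \<inter> fc x \<subseteq> X \<and> fc w \<subseteq> K)" for w
  proof
    assume "w \<in> class_upper G (fcg x) (X \<inter> fc x)"
    then obtain H K where H: "H \<in> factor_components G" "cathedral_le G (fcg x) H" "H \<noteq> fcg x" "w \<in> verts H"
      and K: "K \<in> components (induced G U)" "nbrs G K \<inter> verts (fcg x) \<subseteq> X \<inter> fc x" "verts H \<subseteq> K"
      unfolding class_upper_def class_upper_comps_def U_def by blast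
    obtain u where u: "u \<in> V" "H = fcg u" using H(1) by (auto simp only: factor_components_fcg)
    have wu: "w \<in> fc u" using H(4) u verts_fcg by simp
    have wV: "w \<in> V" and fw: "fc w = fc u" using wu fc_sub[OF u(1)] fc_eq by auto
    have "fc w \<noteq> fc x" using H(3) u fw fcg_eq_iff[OF u(1) xV] by simp
    then have "w \<notin> fc x" using fc_eq by blast
    then have "w \<in> U" using H(2) u(2) fw wV by (simp add: U)
    moreover have "K \<in> comps E U" using K(1) components_induced[OF UV] by simp
    moreover have "nbrs G K \<inter> fc x \<subseteq> X" using K(2) verts_fcg[OF xV] by auto
    moreover have "fc w \<subseteq> K" using K(3) u fw verts_fcg by simp
    ultimately show "w \<in> U \<and> (\<exists>K\<in>comps E U. nbrs G K \<inter> fc x \<subseteq> X \<and> fc w \<subseteq> K)" by blast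
  next
    assume "w \<in> U \<and> (\<exists>K\<in>comps E U. nbrs G K \<inter> fc x \<subseteq> X \<and> fc w \<subseteq> K)"
    then obtain K where wU: "w \<in> U"
      and K: "K \<in> comps E U" "nbrs G K \<inter> fc x \<subseteq> X" "fc w \<subseteq> K" by blast
    then have w: "w \<in> V" "cathedral_le G (fcg x) (fcg w)" "w \<notin> fc x" by (simp_all add: U)
    have "fcg w \<noteq> fcg x" using fcg_eq_iff[OF w(1) xV] w(3) comp_of_refl[of w Al V] by metis
    then have "fcg w \<in> class_upper_comps G (fcg x) (X \<inter> fc x)"
      unfolding class_upper_comps_def
      using w(1,2) K components_induced[OF UV] verts_fcg[OF w(1)] verts_fcg[OF xV]
      by (auto simp: factor_components_fcg U_def)
    moreover have "w \<in> verts (fcg w)" using verts_fcg[OF w(1)] by simp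
    ultimately show "w \<in> class_upper G (fcg x) (X \<inter> fc x)" unfolding class_upper_def by blast
  qed
  have oc_U: "b \<in> U" if "z \<in> X \<inter> fc x" "b \<in> oc z" "b \<notin> fc x" for z b
    using oc_upper[OF x that(1,2)] oc_sub[of z b] that by (auto simp: U)
  show ?thesis
  proof (intro equalityI subsetI)
    fix y assume "y \<in> (\<Union>z\<in>X \<inter> fc x. oc z)"
    then obtain z where z: "z \<in> X \<inter> fc x" "y \<in> oc z" by blast
    have zX: "z \<in> X" and fz: "fc z = fc x" using z fc_eq by auto
    have yV: "y \<in> V" "y \<notin> X" using oc_sub[OF zX z(2)] by auto
    have "y \<in> upper_star G (fcg x)" unfolding US using yV oc_upper[OF x z] by blast
    moreover have "y \<notin> class_upper G (fcg x) (X \<inter> fc x)"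
    proof
      assume "y \<in> class_upper G (fcg x) (X \<inter> fc x)"
      then obtain K where K: "K \<in> comps E U" "nbrs G K \<inter> fc x \<subseteq> X" "fc y \<subseteq> K" unfolding mem by blast
      have KU: "K \<subseteq> U" by (rule comps_sub[OF K(1)])
      \<comment> \<open>A vertex of \<open>oc z\<close> adjacent to \<open>K\<close> either lies in
        \<open>U\<close>, hence in \<open>K\<close>, or is a neighbour of \<open>K\<close> in
        \<open>fc x\<close>, hence in \<open>X\<close>, which \<open>oc z\<close> avoids.\<close>
      have "oc z \<subseteq> K"
      proof (rule comps_subset[of "oc z" E "V - X" y])
        show "oc z \<in> comps E (V - X)" using oc(1)[OF zX] by (simp add: odd_comps_def)
        show "y \<in> oc z" by (rule z(2))
        show "y \<in> K" using K(3) comp_of_refl[of y Al V] by blast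
        fix a b assume ab: "a \<in> oc z" "b \<in> oc z" "a \<in> K" "{a, b} \<in> E"
        show "b \<in> K"
        proof (cases "b \<in> fc x")
          case True
          then have "b \<notin> K" using KU by (auto simp: U)
          then have "b \<in> nbrs G K" using ab oc_sub[OF zX ab(2)] by (auto simp: nbrs_def)
          then show ?thesis using K(2) True oc_sub[OF zX ab(2)] by blast
        next
          case False
          then have "b \<in> U" using oc_U z(1) ab(2) by blast
          then show ?thesis using closed_comps[OF K(1)] ab(3,4) unfolding closed_in_def by blast
        qed
      qed
      moreover have "M z \<in> fc x" using fc_mate[OF M, of z] zX XV fz by auto
      ultimately show False using oc(2)[OF zX] KU by (auto simp: U)
    qed
    ultimately show "y \<in> upper_star G (fcg x) - class_upper_star G (fcg x) (X \<inter> fc x)"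
      using yV by (simp add: class_upper_star_def)
  next
    fix y assume "y \<in> upper_star G (fcg x) - class_upper_star G (fcg x) (X \<inter> fc x)"
    then have y: "y \<in> V" "cathedral_le G (fcg x) (fcg y)" "\<not> (y \<in> X \<and> y \<in> fc x)"
      and ncu: "y \<notin> class_upper G (fcg x) (X \<inter> fc x)"
      unfolding US class_upper_star_def by auto
    show "y \<in> (\<Union>z\<in>X \<inter> fc x. oc z)"
    proof (cases "y \<in> fc x")
      case True
      then show ?thesis using fc_outside_X[OF x True] y(3) by blast
    next
      case False
      then have yU: "y \<in> U" using y by (simp add: U)
      define K where "K = comp_of E U y"
      have K: "K \<in> comps E U" using yU by (simp add: K_def comps_def)
      have KU: "K \<subseteq> U" by (rule comps_sub[OF K])
      \<comment> \<open>The factor-component of \<open>y\<close> is connected inside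
        \<open>U\<close> and so lies within \<open>K\<close>. Since \<open>y\<close> is not in
        \<open>U(S)\<close>, it must be the neighbourhood condition that fails for
        \<open>K\<close>.\<close>
      have "closed_in Al V (fc y \<inter> K)"
        unfolding closed_in_def
      proof (intro conjI ballI impI)
        fix a b assume ab: "a \<in> fc y \<inter> K" "b \<in> V" "{a, b} \<in> Al"
        then have aV: "a \<in> V" using KU UV by blast
        have b: "b \<in> fc y" using comp_of_step[of a Al V y b] ab aV by blast
        then have "b \<in> U" using U_fc[OF yU] by blast
        then have "b \<in> K" using closed_comps[OF K] ab allowed_edges_subset unfolding closed_in_def by blast
        with b show "b \<in> fc y \<inter> K" by blast
      qed (use KU UV in blast)
      from comp_of_subset[OF this, of y] have "fc y \<subseteq> K" by (simp add: K_def)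
      then have "\<not> nbrs G K \<inter> fc x \<subseteq> X" using ncu mem[of y] yU K by blast
      then obtain w u where w: "w \<in> fc x" "w \<notin> X" "w \<in> V" and u: "u \<in> K" "{u, w} \<in> E"
        by (auto simp: nbrs_def)
      obtain z where z: "z \<in> X \<inter> fc x" "w \<in> oc z" using fc_outside_X[OF x w(1,2)] by blast
      have zX: "z \<in> X" using z by blast
      \<comment> \<open>Edges leave \<open>oc z\<close> only towards \<open>X\<close>, and
        \<open>upper_not_adjacent\<close> excludes the vertices of \<open>X\<close> lying in
        \<open>U\<close>.\<close>
      have into: "b \<in> oc z" if b: "b \<in> K" and a: "a \<in> oc z" "{a, b} \<in> E" for a b
      proof -
        have bU: "b \<in> V" "cathedral_le G (fcg x) (fcg b)" "b \<notin> fc x" using b KU by (auto simp: U)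
        have "b \<notin> X"
        proof
          assume "b \<in> X"
          moreover have "{b, a} \<in> E" using a(2) by (simp add: insert_commute)
          ultimately have "fc b = fc x" using upper_not_adjacent[OF x z(1) a(1) _ bU(2)] by blast
          then show False using bU(3) comp_of_refl[of b Al V] by simp
        qed
        then show ?thesis using OC_step[OF oc(1)[OF zX] a] by blast
      qed
      have "{w, u} \<in> E" using u(2) by (simp add: insert_commute)
      then have "u \<in> oc z" by (rule into[OF u(1) z(2)])
      have "K \<subseteq> oc z"
        by (rule comps_subset[OF K u(1) \<open>u \<in> oc z\<close>]) (rule into)
      then have "y \<in> oc z" by (auto simp: K_def)
      with z(1) show ?thesis by blast
    qed
  qed
qed

end

section \<open>Enumeration of the classes that make up the barrier\<close>

theorem mainTheorem1:
  fixes G :: "'a graph" and X :: "'a set"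
  assumes "fin_graph G"
    and "factorizable G"
    and "X \<subseteq> verts G"
    and "odd_maximal_barrier G X"
  shows "\<exists>(k::nat) (S :: nat \<Rightarrow> 'a set) (C :: nat \<Rightarrow> 'a graph).
    (\<forall>i\<in>{1..k}. S i \<in> gen_canonical_partition G) \<and>
    disjoint_family_on S {1..k} \<and>
    X = (\<Union>i\<in>{1..k}. S i) \<and>
    (\<forall>i\<in>{1..k}. C i \<in> factor_components G \<and>
       (\<forall>H\<in>factor_components G. S i \<in> partition_of G H \<longleftrightarrow> H = C i)) \<and>
    disjoint_family_on (\<lambda>i. upper_star G (C i) - class_upper_star G (C i) (S i)) {1..k} \<and>
    odd_verts G X = (\<Union>i\<in>{1..k}. upper_star G (C i) - class_upper_star G (C i) (S i))"
proof -
  interpret odd_maximal G X by unfold_locales (fact assms)+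
  \<comment> \<open>One index for each factor-component meeting \<open>X\<close>: every such
    component contributes exactly one class, its intersection with \<open>X\<close>.\<close>
  obtain h where h: "bij_betw h {1..card (fc ` X)} (fc ` X)"
    using ex_bij_betw_nat_finite_1[of "fc ` X"] finX by blast
  define I where "I = {1..card (fc ` X)}"
  have "\<forall>i\<in>I. \<exists>x. x \<in> X \<and> h i = fc x" using bij_betwE[OF h] unfolding I_def by blast
  then obtain r where r: "\<And>i. i \<in> I \<Longrightarrow> r i \<in> X \<and> h i = fc (r i)" by metis
  define S where "S i = X \<inter> fc (r i)" for i
  define C where "C i = fcg (r i)" for i
  have rV: "r i \<in> V" if "i \<in> I" for i using r[OF that] XV by blast
  have rS: "r i \<in> S i" if "i \<in> I" for i using r[OF that] by (simp add: S_def)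
  have inj: "i = j" if "i \<in> I" "j \<in> I" "fc (r i) = fc (r j)" for i j
    using bij_betw_imp_inj_on[OF h] r[OF that(1)] r[OF that(2)] that unfolding I_def inj_on_def by metis
  have S_disj: "S i \<inter> S j = {}" if "i \<in> I" "j \<in> I" "i \<noteq> j" for i j
    using inj[OF that(1,2)] that(3) fc_eq unfolding S_def by blast
  have cover: "\<exists>i\<in>I. x \<in> S i" if x: "x \<in> X" for x
  proof -
    have "fc x \<in> h ` I" using bij_betw_imp_surj_on[OF h] x unfolding I_def by blast
    then obtain i where i: "i \<in> I" "fc x = fc (r i)" using r by auto
    then have "x \<in> S i" using x comp_of_refl[of x Al V] by (simp add: S_def)
    with i show ?thesis by blast
  qed
  have SX: "S i \<subseteq> X" for i by (simp add: S_def)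
  have S_class: "S i \<in> gen_canonical_partition G" if "i \<in> I" for i
    unfolding gen_canonical_partition_def S_def canonical_class[OF conjunct1[OF r[OF that]], symmetric]
    by (rule quotientI[OF rV[OF that]])
  have C_fc: "C i \<in> factor_components G" if "i \<in> I" for i
    using rV[OF that] by (simp add: C_def factor_components_fcg)
  \<comment> \<open>\<open>S i\<close> contains \<open>r i\<close>, and a vertex lies in only one
    factor-component.\<close>
  have part: "S i \<in> partition_of G H \<longleftrightarrow> H = C i" if i: "i \<in> I" and "H \<in> factor_components G" for i H
  proof -
    obtain v where v: "v \<in> V" "H = fcg v" using \<open>H \<in> factor_components G\<close> by (auto simp: factor_components_fcg)
    have "S i \<in> partition_of G H \<longleftrightarrow> S i \<subseteq> fc v"
      unfolding partition_of_def v(2) verts_fcg[OF v(1)] using S_class[OF i] by blast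
    also have "\<dots> \<longleftrightarrow> fc v = fc (r i)"
      using rS[OF i] fc_eq[of "r i" v] by (auto simp: S_def)
    also have "\<dots> \<longleftrightarrow> H = C i"
      unfolding v(2) C_def using fcg_eq_iff[OF v(1) rV[OF i]] by simp
    finally show ?thesis .
  qed
  have D: "upper_star G (C i) - class_upper_star G (C i) (S i) = (\<Union>z\<in>S i. oc z)" if "i \<in> I" for i
    unfolding C_def S_def using upper_star_diff r[OF that] by blast
  have D_disj: "(\<Union>z\<in>S i. oc z) \<inter> (\<Union>z\<in>S j. oc z) = {}" if "i \<in> I" "j \<in> I" "i \<noteq> j" for i j
    using S_disj[OF that] SX oc_inj by blast
  have UX: "X = (\<Union>i\<in>I. S i)" using cover SX by blast
  have "odd_verts G X = (\<Union>i\<in>I. \<Union>z\<in>S i. oc z)"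
    unfolding odd_verts_def odd_components_eq union_oc using UX by blast
  then have UD: "odd_verts G X = (\<Union>i\<in>I. upper_star G (C i) - class_upper_star G (C i) (S i))"
    using D by simp
  show ?thesis
    by (rule exI[of _ "card (fc ` X)"], rule exI[of _ S], rule exI[of _ C], fold I_def, intro conjI UX UD)
      (use S_class S_disj C_fc part D D_disj in \<open>auto simp: disjoint_family_on_def\<close>)
qed

end
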